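(* Let $F$ be a field, let $D$ be a division algebra with center $F$ and degree $d>2$, let $K|F$ be any splitting field of $D$, and regard $D$ as an $F$-subalgebra of $M_d(K)$ via a splitting representation, so that $D^\times\le \mathrm{GL}_d(K)$. Let $N\le \mathrm{GL}_d(K)$ be the subgroup of monomial matrices and $T\le N$ the subgroup of invertible diagonal matrices, and identify $N/T$ with the symmetric group $S_d$. Let $X$ be any coset in $N/T$ whose cycle decomposition features a lonely $k$-cycle. Let $z\in D^\times$ and $g\in\mathrm{GL}_d(K)$. Then $gzg^{-1}\notin X$.
   Context: A division algebra $D$ with center $F$ has degree $d$ if $\dim_F(D)=d^2$. A splitting field of $D$ is a field extension $K|F$ with $D\otimes_F K\cong M_d(K)$; a splitting representation is the resulting injective $F$-algebra homomorphism $D\hookrightarrow D\otimes_F K\cong M_d(K)$. A monomial matrix is one with exactly one nonzero entry in each row and column; the coset $nT$ of a monomial matrix $n$ corresponds to the permutation of $\{1,\dots,d\}$ given by the positions of the nonzero entries of $n$, which gives the identification $N/T\cong S_d$. Lonely cycles: let $\sigma\in S_d$ have cycle decomposition $\sigma=\sigma_1\cdots\sigma_m$, where $\sigma_i$ is a $k_i$-cycle and fixed points are included as $1$-cycles (so $k_1+\dots+k_m=d$). The cycle $\sigma_i$ is called lonely if both of the following hold: (1) for any $\epsilon_1,\dots,\epsilon_m\in\{0,1\}$, if $k_i=\sum_{j=1}^m\epsilon_jk_j$ then $\epsilon_j=0$ for all $j\neq i$; (2) if $k_i$ is maximal among all the $k_j$, then $k_i$ does not divide $d$. *)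

theory Defs
  imports
    "Jordan_Normal_Form.Matrix"
    "HOL-Library.Poly_Mapping"
    "HOL-Algebra.QuotRing"
    "HOL-Algebra.Generated_Groups"
    "HOL-Combinatorics.Orbits"
begin

section \<open>Central division algebras\<close>

definition center :: "'a::ring_1 set" where
  "center = {x. \<forall>y. x * y = y * x}"

text \<open>The field \<open>F\<close> is a type of its own; the structure map \<open>\<iota>\<close> identifies it with
  the center of \<open>D\<close> (it is injective because \<open>F\<close> is a field and \<open>1 \<noteq> 0\<close> in \<open>D\<close>).\<close>

definition central_division_algebra :: "('f::field \<Rightarrow> 'd::division_ring) \<Rightarrow> bool" where
  "central_division_algebra \<iota> \<longleftrightarrow> Ring_Hom.ring_hom \<iota> \<and> range \<iota> = center"

text \<open>The library sets the dimension of an infinite-dimensional space to \<open>0\<close>, so for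
  \<open>d > 0\<close> this entails that \<open>D\<close> is finite-dimensional over \<open>F\<close>.\<close>

definition has_degree :: "('f::field \<Rightarrow> 'd::division_ring) \<Rightarrow> nat \<Rightarrow> bool" where
  "has_degree \<iota> d \<longleftrightarrow> vector_space.dim (\<lambda>a x. \<iota> a * x) (UNIV :: 'd set) = d\<^sup>2"


section \<open>The tensor product of two algebras\<close>

text \<open>The generators \<open>(x, c) \<in> D \<times> K\<close> of the tensor product, as a monoid under
  \<open>(x, c)(y, c') = (x y, c c')\<close>. It is written additively because that is how finitely supported
  functions (\<open>\<Rightarrow>\<^sub>0\<close>) form a monoid ring: the type \<open>('d, 'k) tensor_gen \<Rightarrow>\<^sub>0 int\<close> is
  the free abelian group on \<open>D \<times> K\<close> with the multiplication that extends that of the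
  generators biadditively.\<close>

datatype ('d, 'k) tensor_gen = Gen 'd 'k

instantiation tensor_gen :: (monoid_mult, monoid_mult) monoid_add
begin

definition zero_tensor_gen :: "('a, 'b) tensor_gen" where
  "0 = Gen 1 1"

fun plus_tensor_gen :: "('a, 'b) tensor_gen \<Rightarrow> ('a, 'b) tensor_gen \<Rightarrow> ('a, 'b) tensor_gen" where
  "Gen x c + Gen y c' = Gen (x * y) (c * c')"

instance
proof
  fix a b c :: "('a, 'b) tensor_gen"
  show "a + b + c = a + (b + c)"
    by (cases a; cases b; cases c) (simp add: mult.assoc)
  show "0 + a = a" "a + 0 = a"
    by (cases a; simp add: zero_tensor_gen_def)+
qed

end

abbreviation gen :: "'d::ring_1 \<Rightarrow> 'k::ring_1 \<Rightarrow> ('d, 'k) tensor_gen \<Rightarrow>\<^sub>0 int" where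
  "gen x c \<equiv> Poly_Mapping.single (Gen x c) 1"

definition gen_ring :: "(('d::ring_1, 'k::ring_1) tensor_gen \<Rightarrow>\<^sub>0 int) ring" where
  "gen_ring = \<lparr>carrier = UNIV, monoid.mult = (*), one = 1, ring.zero = 0, add = (+)\<rparr>"

definition tensor_relations ::
  "('f \<Rightarrow> 'd::ring_1) \<Rightarrow> ('f \<Rightarrow> 'k::ring_1) \<Rightarrow> (('d, 'k) tensor_gen \<Rightarrow>\<^sub>0 int) set" where
  "tensor_relations \<iota> j =
     {gen (x + y) c - gen x c - gen y c | x y c. True} \<union>
     {gen x (c + c') - gen x c - gen x c' | x c c'. True} \<union>
     {gen (x * \<iota> a) c - gen x (j a * c) | x a c. True}"

text \<open>When the images of the structure maps \<open>\<iota>\<close>, \<open>j\<close> are central, the ideal generated by the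
  relations is just the additive subgroup they generate (\<open>tensor_ideal_eq_generate\<close> below),
  so the quotient is the usual tensor product over \<open>F\<close> of the two \<open>F\<close>-algebras.\<close>

definition tensor_ideal ::
  "('f \<Rightarrow> 'd::ring_1) \<Rightarrow> ('f \<Rightarrow> 'k::ring_1) \<Rightarrow> (('d, 'k) tensor_gen \<Rightarrow>\<^sub>0 int) set" where
  "tensor_ideal \<iota> j = genideal gen_ring (tensor_relations \<iota> j)"

definition tensor_algebra ::
  "('f \<Rightarrow> 'd::ring_1) \<Rightarrow> ('f \<Rightarrow> 'k::ring_1) \<Rightarrow> (('d, 'k) tensor_gen \<Rightarrow>\<^sub>0 int) set ring" where
  "tensor_algebra \<iota> j = gen_ring Quot tensor_ideal \<iota> j"

definition pure_tensor ::
  "('f \<Rightarrow> 'd::ring_1) \<Rightarrow> ('f \<Rightarrow> 'k::ring_1) \<Rightarrow> 'd \<Rightarrow> 'k \<Rightarrow> (('d, 'k) tensor_gen \<Rightarrow>\<^sub>0 int) set" where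
  "pure_tensor \<iota> j x c = tensor_ideal \<iota> j +>\<^bsub>gen_ring\<^esub> gen x c"

lemma ring_gen_ring: "ring (gen_ring :: (('d::ring_1, 'k::ring_1) tensor_gen \<Rightarrow>\<^sub>0 int) ring)"
proof -
  have "\<exists>y. x + y = 0" for x :: "('d, 'k) tensor_gen \<Rightarrow>\<^sub>0 int"
    using add.right_inverse by blast
  then show ?thesis
    unfolding gen_ring_def using add.right_inverse
    by unfold_locales (auto simp: algebra_simps Units_def)
qed

lemma ideal_tensor_ideal: "ideal (tensor_ideal \<iota> j) gen_ring"
  unfolding tensor_ideal_def
  by (rule ring.genideal_ideal[OF ring_gen_ring]) (simp add: gen_ring_def)

lemma ring_tensor_algebra: "ring (tensor_algebra \<iota> j)"
  unfolding tensor_algebra_def by (rule ideal.quotient_is_ring[OF ideal_tensor_ideal])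

lemma tensor_ideal_eq_generate:
  fixes \<iota> :: "'f \<Rightarrow> 'd::ring_1" and j :: "'f \<Rightarrow> 'k::comm_ring_1"
  assumes central: "range \<iota> \<subseteq> center"
  shows "tensor_ideal \<iota> j = generate (add_monoid gen_ring) (tensor_relations \<iota> j)"
proof -
  let ?R = "gen_ring :: (('d, 'k) tensor_gen \<Rightarrow>\<^sub>0 int) ring"
  let ?S = "generate (add_monoid ?R) (tensor_relations \<iota> j)"
  interpret R: ring ?R by (rule ring_gen_ring)
  have carr: "carrier ?R = UNIV" and mlt: "monoid.mult ?R = (*)"
    and plus: "add ?R = (+)" and zero: "ring.zero ?R = 0"
    by (simp_all add: gen_ring_def)
  have comm: "\<iota> a * y = y * \<iota> a" for a y
    using central by (auto simp: center_def)
  have sub: "subgroup ?S (add_monoid ?R)"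
    by (rule R.add.generate_is_subgroup) (simp add: carr)
  have s0: "0 \<in> ?S"
    using subgroup.one_closed[OF sub] by (simp add: zero)
  have s_add: "u + v \<in> ?S" if "u \<in> ?S" "v \<in> ?S" for u v
    using subgroup.m_closed[OF sub that] by (simp add: plus)
  have a_inv: "inv\<^bsub>add_monoid ?R\<^esub> u = - u" for u
    unfolding a_inv_def[symmetric] by (rule R.minus_equality) (simp_all add: carr plus zero)
  have s_neg: "- u \<in> ?S" if "u \<in> ?S" for u
    using subgroup.m_inv_closed[OF sub that] unfolding a_inv .
  have s_int: "of_int n * u \<in> ?S" if "u \<in> ?S" for n u
  proof (induction n rule: int_induct[where k = 0])
    case (step1 i) show ?case using s_add[OF step1(2) that] by (simp add: distrib_right)
  next
    case (step2 i) show ?case using s_add[OF step2(2) s_neg[OF that]] by (simp add: left_diff_distrib)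
  qed (use s0 in simp)
  have int_gen: "Poly_Mapping.single t n = of_int n * Poly_Mapping.single t 1" for t :: "('d, 'k) tensor_gen" and n :: int
    by (simp add: mult_single flip: single_of_int)
  have gen_rel: "gen y e * u \<in> tensor_relations \<iota> j \<and> u * gen y e \<in> tensor_relations \<iota> j"
    if "u \<in> tensor_relations \<iota> j" for u y e
  proof -
    from that consider
        (1) x x' c where "u = gen (x + x') c - gen x c - gen x' c"
      | (2) x c c' where "u = gen x (c + c') - gen x c - gen x c'"
      | (3) x a c where "u = gen (x * \<iota> a) c - gen x (j a * c)"
      unfolding tensor_relations_def by blast
    then show ?thesis
    proof cases
      case 1
      have "gen y e * u = gen (y * x + y * x') (e * c) - gen (y * x) (e * c) - gen (y * x') (e * c)"
        "u * gen y e = gen (x * y + x' * y) (c * e) - gen (x * y) (c * e) - gen (x' * y) (c * e)"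
        by (simp_all add: 1 algebra_simps mult_single)
      then show ?thesis unfolding tensor_relations_def by blast
    next
      case 2
      have "gen y e * u = gen (y * x) (e * c + e * c') - gen (y * x) (e * c) - gen (y * x) (e * c')"
        "u * gen y e = gen (x * y) (c * e + c' * e) - gen (x * y) (c * e) - gen (x * y) (c' * e)"
        by (simp_all add: 2 algebra_simps mult_single)
      then show ?thesis unfolding tensor_relations_def by blast
    next
      case 3
      have "gen y e * u = gen ((y * x) * \<iota> a) (e * c) - gen (y * x) (j a * (e * c))"
        by (simp add: 3 right_diff_distrib mult_single mult.assoc mult.left_commute[of e])
      moreover have "u * gen y e = gen ((x * y) * \<iota> a) (c * e) - gen (x * y) (j a * (c * e))"
        by (simp add: 3 left_diff_distrib mult_single mult.assoc comm)
      ultimately show ?thesis unfolding tensor_relations_def by blast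
    qed
  qed
  have gen_S: "gen y e * u \<in> ?S \<and> u * gen y e \<in> ?S" if "u \<in> ?S" for u y e
    using that
  proof induction
    case one then show ?case using s0 by (simp add: zero)
  next
    case (incl h) then show ?case using gen_rel generate.incl by metis
  next
    case (inv h)
    have "gen y e * h \<in> ?S" "h * gen y e \<in> ?S"
      using gen_rel[OF inv] by (auto intro: generate.incl)
    then have "- (gen y e * h) \<in> ?S" "- (h * gen y e) \<in> ?S"
      using s_neg by blast+
    then show ?case unfolding a_inv by simp
  next
    case (eng h h')
    have "h \<otimes>\<^bsub>add_monoid ?R\<^esub> h' = h + h'" by (simp add: plus)
    then show ?case
      using s_add[OF conjunct1[OF eng(3)] conjunct1[OF eng(4)]]
        s_add[OF conjunct2[OF eng(3)] conjunct2[OF eng(4)]]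
      by (simp only: distrib_left distrib_right)
  qed
  have all_S: "r * u \<in> ?S \<and> u * r \<in> ?S" if u: "u \<in> ?S" for r u
  proof (induction r rule: update_induct)
    case const then show ?case using s0 by simp
  next
    case (update f t n)
    have eq: "Poly_Mapping.update t n f = f + of_int n * Poly_Mapping.single t 1"
      using update(1) unfolding int_gen[symmetric]
      by (intro poly_mapping_eqI) (auto simp: lookup_update lookup_add lookup_single in_keys_iff when_def)
    obtain y e where t: "t = Gen y e" by (cases t)
    let ?m = "Poly_Mapping.single t 1"
    have "of_int n * (?m * u) \<in> ?S" "of_int n * (u * ?m) \<in> ?S"
      using gen_S[OF u, of y e] unfolding t by (blast intro: s_int)+
    then have "f * u + of_int n * (?m * u) \<in> ?S" "u * f + of_int n * (u * ?m) \<in> ?S"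
      using update(3) by (blast intro: s_add)+
    moreover have "u * (of_int n * ?m) = of_int n * (u * ?m)"
      by (metis mult.assoc mult_of_int_commute)
    ultimately show ?case
      by (simp only: eq distrib_left distrib_right mult.assoc simp_thms)
  qed
  have "ideal ?S ?R"
    by (rule idealI[OF ring_gen_ring sub]) (use all_S in \<open>auto simp: mlt\<close>)
  then have "tensor_ideal \<iota> j \<subseteq> ?S"
    unfolding tensor_ideal_def by (rule R.genideal_minimal) (auto intro: generate.incl)
  moreover have "?S \<subseteq> tensor_ideal \<iota> j"
  proof -
    interpret I: ideal "tensor_ideal \<iota> j" ?R by (rule ideal_tensor_ideal)
    have "tensor_relations \<iota> j \<subseteq> tensor_ideal \<iota> j"
      unfolding tensor_ideal_def by (rule R.genideal_self) (simp add: carr)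
    then show ?thesis
      by (rule R.add.generate_subgroup_incl[OF _ I.a_subgroup])
  qed
  ultimately show ?thesis by blast
qed


section \<open>Splitting representations\<close>

text \<open>\<open>\<psi>\<close> is an isomorphism of \<open>K\<close>-algebras from \<open>D \<otimes>\<^sub>F K\<close> to \<open>M\<^sub>d(K)\<close>; the map
  \<open>\<phi>\<close> is its composition with \<open>x \<mapsto> x \<otimes> 1\<close>. The existence of \<open>\<phi>\<close> says that \<open>K\<close> is a
  splitting field.\<close>

definition splitting_representation ::
  "('f::field \<Rightarrow> 'd::division_ring) \<Rightarrow> ('f \<Rightarrow> 'k::field) \<Rightarrow> nat \<Rightarrow> ('d \<Rightarrow> 'k mat) \<Rightarrow> bool" where
  "splitting_representation \<iota> j d \<phi> \<longleftrightarrow>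
     (\<exists>\<psi> \<in> ring_iso (tensor_algebra \<iota> j) (ring_mat TYPE('k) d ()).
        (\<forall>c. \<psi> (pure_tensor \<iota> j 1 c) = c \<cdot>\<^sub>m 1\<^sub>m d) \<and>
        (\<forall>x. \<phi> x = \<psi> (pure_tensor \<iota> j x 1)))"


section \<open>Monomial matrices and their permutations\<close>

definition GL :: "nat \<Rightarrow> 'k::field mat monoid" where
  "GL d = units_of (ring_mat TYPE('k) d ())"

definition monomial_mat :: "'k::zero mat \<Rightarrow> bool" where
  "monomial_mat A \<longleftrightarrow>
     (\<forall>i<dim_row A. \<exists>!j. j < dim_col A \<and> A $$ (i, j) \<noteq> 0) \<and>
     (\<forall>j<dim_col A. \<exists>!i. i < dim_row A \<and> A $$ (i, j) \<noteq> 0)"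

definition monomial_group :: "nat \<Rightarrow> 'k::field mat set" where
  "monomial_group d = {A \<in> carrier (GL d). monomial_mat A}"

definition diagonal_group :: "nat \<Rightarrow> 'k::field mat set" where
  "diagonal_group d = {A \<in> carrier (GL d). diagonal_mat A}"

definition weyl_group :: "nat \<Rightarrow> 'k::field mat set monoid" where
  "weyl_group d = (GL d)\<lparr>carrier := monomial_group d\<rparr> Mod diagonal_group d"

text \<open>The permutation \<open>\<sigma>\<close> of \<open>{0..<d}\<close> with \<open>A\<^sub>i\<^sub>j \<noteq> 0 \<longleftrightarrow> i = \<sigma> j\<close>, that is, \<open>A\<close> maps the
  \<open>j\<close>-th basis vector to a multiple of the \<open>\<sigma> j\<close>-th one. Outside \<open>{0..<d}\<close> it is the identity.\<close>

definition monomial_perm :: "'k::zero mat \<Rightarrow> nat \<Rightarrow> nat" where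
  "monomial_perm A j =
     (if j < dim_col A then THE i. i < dim_row A \<and> A $$ (i, j) \<noteq> 0 else j)"

definition coset_perm :: "'k::zero mat set \<Rightarrow> nat \<Rightarrow> nat" where
  "coset_perm X = (THE \<sigma>. \<forall>n\<in>X. monomial_perm n = \<sigma>)"


section \<open>Lonely cycles\<close>

text \<open>A cycle is represented by its support, with \<open>{x}\<close> for a fixed point \<open>x\<close>; its length is the
  cardinality of the support.\<close>

definition cycles :: "nat \<Rightarrow> (nat \<Rightarrow> nat) \<Rightarrow> nat set set" where
  "cycles d \<sigma> = orbit \<sigma> ` {0..<d}"

definition lonely :: "nat \<Rightarrow> (nat \<Rightarrow> nat) \<Rightarrow> nat set \<Rightarrow> bool" where
  "lonely d \<sigma> C \<longleftrightarrow>
     (\<forall>\<epsilon>. \<epsilon> ` cycles d \<sigma> \<subseteq> {0, 1 :: nat} \<longrightarrow> card C = (\<Sum>B\<in>cycles d \<sigma>. \<epsilon> B * card B) \<longrightarrow>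
          (\<forall>B\<in>cycles d \<sigma>. B \<noteq> C \<longrightarrow> \<epsilon> B = 0)) \<and>
     ((\<forall>B\<in>cycles d \<sigma>. card B \<le> card C) \<longrightarrow> \<not> card C dvd d)"

end

theory Submission
  imports
    Defs
    "HOL-Library.Function_Algebras"
    "Jordan_Normal_Form.Char_Poly"
begin

text \<open>Suppose that \<open>A = g z g\<^sup>-\<^sup>1\<close> is monomial with permutation \<open>\<sigma>\<close>. The basis vectors in a cycle \<open>B\<close> of \<open>\<sigma>\<close>
  span a subspace of \<open>K\<^sup>d\<close> that is stable under \<open>A\<close>; as a module over \<open>K[x]\<close>, with \<open>x\<close> acting as \<open>A\<close>, it is the cyclic
  module \<open>K[x]/(x\<^sup>k - a)\<close>, where \<open>k = |B|\<close> and \<open>a = a\<^sub>B \<noteq> 0\<close> is the product of the entries of \<open>A\<close>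
  along the cycle. So \<open>M\<^sub>d(K)\<close>, which is \<open>d\<close> copies of \<open>K\<^sup>d\<close> (its columns), is a direct sum of such
  modules (\<open>cyclic_decomp_cycles\<close>).

  The division algebra gives a second description of the same module. Let \<open>f\<close> be the minimal polynomial
  of \<open>z\<close> over \<open>F\<close> and \<open>n\<close> its degree. As \<open>D\<close> is a vector space over the field \<open>F(z) = F[x]/(f)\<close>
  (\<open>free_over_generated_subfield\<close>) and an \<open>F\<close>-basis of \<open>D\<close> is mapped to a \<open>K\<close>-basis of \<open>M\<^sub>d(K)\<close>, the
  latter is a direct sum of \<open>d\<^sup>2/n\<close> copies of \<open>K[x]/(f)\<close> (\<open>cyclic_decomp_transfer\<close>). The uniqueness part
  of the structure theorem for torsion modules over \<open>K[x]\<close> (\<open>cyclic_decomp_card_dvd_unique\<close>,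
  \<open>cyclic_decomp_prod_unique\<close>) then shows that \<open>n\<close> divides \<open>d\<close> and that
  \<open>\<Prod>\<^sub>B (x\<^bsup>|B|\<^esup> - a\<^sub>B) = f\<^bsup>d/n\<^esup>\<close> (\<open>prod_cycle_poly\<close>). In particular the product on the left, the
  characteristic polynomial of \<open>A\<close>, has its coefficients in \<open>F\<close>.

  Now let \<open>C\<close> be a cycle of length \<open>k\<close> (\<open>not_lonely\<close>). If no other set of cycles has lengths with
  sum \<open>k\<close>, the coefficient of \<open>x\<^bsup>d-k\<^esup>\<close> is \<open>-a\<^sub>C\<close>, so \<open>a\<^sub>C\<close> is an element \<open>\<alpha>\<close> of \<open>F\<close>. The matrix
  \<open>A\<^sup>k - \<alpha>\<close> kills the basis vectors of \<open>C\<close>, so the element \<open>z\<^sup>k - \<alpha>\<close> of \<open>D\<close> is not invertible, hence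
  zero. Therefore \<open>A\<^sup>k\<close> is scalar, so no cycle is longer than \<open>C\<close>, and \<open>f\<close> divides \<open>x\<^sup>k - \<alpha>\<close>. On the
  other hand \<open>f(A) = 0\<close>, so \<open>x\<^sup>k - \<alpha>\<close> divides \<open>f\<close>. It follows that \<open>k = n\<close> divides \<open>d\<close>, although
  \<open>k\<close> is the maximal cycle length, and \<open>C\<close> is not lonely.\<close>


section \<open>Removing a prime factor from a polynomial\<close>

definition strip_factor :: "'a::field poly \<Rightarrow> 'a poly \<Rightarrow> 'a poly" where
  "strip_factor p h = (if p dvd h then h div p else h)"

lemma strip_factor_monic:
  assumes "monic p" "monic h"
  shows "monic (strip_factor p h)"
proof (cases "p dvd h")
  case True
  then obtain t where t: "h = p * t" by (elim dvdE)
  have "p \<noteq> 0" using assms by auto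
  then show ?thesis using t assms
    by (simp add: strip_factor_def lead_coeff_mult)
qed (use assms in \<open>simp add: strip_factor_def\<close>)

lemma strip_factor_mult:
  assumes "monic p"
  shows "strip_factor p h * (if p dvd h then p else 1) = h"
  using assms by (auto simp: strip_factor_def)

lemma degree_strip_factor:
  assumes "monic p" "monic h"
  shows "degree (strip_factor p h) + (if p dvd h then degree p else 0) = degree h"
proof -
  have "strip_factor p h \<noteq> 0" "p \<noteq> 0"
    using strip_factor_monic[OF assms] assms by auto
  then have "degree (strip_factor p h * (if p dvd h then p else 1))
      = degree (strip_factor p h) + (if p dvd h then degree p else 0)"
    by (auto simp: degree_mult_eq)
  then show ?thesis by (simp add: strip_factor_mult[OF assms(1)])
qed

text \<open>If the polynomials killing a vector are the multiples of \<open>h\<close>, then those killing its image under a prime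
  \<open>p\<close> are the multiples of \<open>strip_factor p h\<close>: a prime that does not divide \<open>h\<close> can be cancelled.\<close>

lemma strip_factor_dvd:
  assumes "prime_elem p" "h dvd r * p"
  shows "strip_factor p h dvd r"
proof -
  from assms(2) obtain t where t: "r * p = h * t" by (elim dvdE)
  have p0: "p \<noteq> 0" using assms(1) by auto
  show ?thesis
  proof (cases "p dvd h")
    case True
    then obtain h1 where h1: "h = p * h1" by (elim dvdE)
    then have "p * r = p * (h1 * t)" using t by (simp add: ac_simps)
    then have "r = h1 * t" using p0 by simp
    then show ?thesis using h1 p0 True by (simp add: strip_factor_def)
  next
    case False
    have "p dvd h * t" using t by (metis dvd_triv_right)
    then have "p dvd t" using False assms(1) by (simp add: prime_elem_dvd_mult_iff)
    then obtain t1 where "t = p * t1" by (elim dvdE)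
    then have "p * r = p * (h * t1)" using t by (simp add: ac_simps)
    then have "r = h * t1" using p0 by simp
    then show ?thesis using False by (simp add: strip_factor_def)
  qed
qed

lemma prod_strip_factor:
  assumes "finite I" "monic p"
  shows "prod h I = prod (\<lambda>s. strip_factor p (h s)) I * p ^ card {s \<in> I. p dvd h s}"
proof -
  have "prod h I = (\<Prod>s\<in>I. strip_factor p (h s) * (if p dvd h s then p else 1))"
    using strip_factor_mult[OF assms(2)] by simp
  also have "\<dots> = prod (\<lambda>s. strip_factor p (h s)) I * (\<Prod>s\<in>I. if p dvd h s then p else 1)"
    by (rule prod.distrib)
  also have "(\<Prod>s\<in>I. if p dvd h s then p else 1) = p ^ card {s \<in> I. p dvd h s}"
    using assms(1) by (simp add: prod.If_cases Int_def)
  finally show ?thesis .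
qed

lemma sum_degree_strip_factor:
  assumes "finite I" "monic p" "\<And>s. s \<in> I \<Longrightarrow> monic (h s)"
  shows "(\<Sum>s\<in>I. degree (h s))
    = (\<Sum>s\<in>I. degree (strip_factor p (h s))) + card {s \<in> I. p dvd h s} * degree p"
proof -
  have "(\<Sum>s\<in>I. degree (h s))
      = (\<Sum>s\<in>I. degree (strip_factor p (h s)) + (if p dvd h s then degree p else 0))"
    by (rule sum.cong) (simp_all add: degree_strip_factor assms)
  also have "\<dots> = (\<Sum>s\<in>I. degree (strip_factor p (h s)))
      + (\<Sum>s\<in>I. if p dvd h s then degree p else 0)"
    by (rule sum.distrib)
  also have "(\<Sum>s\<in>I. if p dvd h s then degree p else 0) = card {s \<in> I. p dvd h s} * degree p"
    using assms(1) by (simp add: sum.If_cases Int_def)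
  finally show ?thesis .
qed

lemma prime_elem_degree_pos:
  fixes p :: "'b::field poly"
  assumes "prime_elem p" shows "degree p > 0"
  using assms by (metis degree_eq_zeroE is_unit_pCons_iff neq0_conv pCons_0_0 prime_elem_def)

lemma coeff_mod_eq_0:
  assumes "monic h" "degree h \<le> i" shows "coeff (r mod h) i = 0"
proof (rule ccontr)
  assume a: "coeff (r mod h) i \<noteq> 0"
  then have "r mod h \<noteq> 0" by auto
  moreover have "h \<noteq> 0" using assms by auto
  ultimately have "degree (r mod h) < degree h" by (intro degree_mod_less') auto
  with le_degree[OF a] assms(2) show False by simp
qed


section \<open>Decompositions into cyclic modules\<close>

text \<open>The two lemmas on bases speak of indexed families, because the vectors \<open>T\<^sup>i v\<^sub>s\<close> below are given by
  their indices, and that no two of them coincide is part of what has to be shown.\<close>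

context vector_space
begin

lemma independent_familyI:
  assumes fin: "finite J"
    and zero: "\<And>u i. (\<Sum>i\<in>J. u i *s w i) = 0 \<Longrightarrow> i \<in> J \<Longrightarrow> u i = 0"
  shows "inj_on w J" "independent (w ` J)"
proof -
  show inj: "inj_on w J"
  proof (rule inj_onI, rule ccontr)
    fix x y assume xy: "x \<in> J" "y \<in> J" "w x = w y" "x \<noteq> y"
    define u where "u i = (if i = x then 1 else if i = y then -1 else 0 :: 'a)" for i
    have "(\<Sum>i\<in>J. u i *s w i) = (\<Sum>i\<in>{x, y}. u i *s w i)"
      by (rule sum.mono_neutral_right) (use fin xy in \<open>auto simp: u_def\<close>)
    also have "\<dots> = 0" using xy by (simp add: u_def)
    finally have "u x = 0" by (rule zero) (rule xy)
    then show False by (simp add: u_def)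
  qed
  show "independent (w ` J)"
  proof (rule independent_if_scalars_zero)
    fix f x assume f: "(\<Sum>x\<in>w ` J. f x *s x) = 0" and "x \<in> w ` J"
    then obtain i where i: "x = w i" "i \<in> J" by auto
    have "(\<Sum>i\<in>J. f (w i) *s w i) = 0" using f by (simp add: sum.reindex[OF inj])
    then show "f x = 0" using zero[of "\<lambda>i. f (w i)" i] i by simp
  qed (use fin in simp)
qed

lemma family_zero_coeffs:
  assumes fin: "finite J" and card: "card J \<le> dim (span (w ` J))"
    and sum: "(\<Sum>i\<in>J. u i *s w i) = 0" and i: "i \<in> J"
  shows "u i = 0"
proof (rule ccontr)
  assume u: "u i \<noteq> 0"
  let ?S = "span (w ` (J - {i}))"
  have "(\<Sum>l\<in>J. u l *s w l) = u i *s w i + (\<Sum>l\<in>J - {i}. u l *s w l)"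
    by (rule sum.remove[OF fin i])
  then have "u i *s w i = - (\<Sum>l\<in>J - {i}. u l *s w l)"
    using sum by (simp add: eq_neg_iff_add_eq_0)
  also have "\<dots> \<in> ?S"
    by (intro span_neg span_sum span_scale span_base) auto
  finally have "inverse (u i) *s (u i *s w i) \<in> ?S" by (rule span_scale)
  then have "w i \<in> ?S" using u by simp
  then have "w ` J \<subseteq> ?S" using i by (auto intro: span_base)
  then have "span (w ` J) \<subseteq> ?S" by (rule span_minimal) simp
  then have "dim (span (w ` J)) \<le> card (w ` (J - {i}))"
    by (rule dim_le_card) (use fin in simp)
  also have "\<dots> \<le> card (J - {i})" using fin by (intro card_image_le) simp
  also have "\<dots> < card J" using fin i by (rule card_Diff1_less)
  finally show False using card by simp
qed

end

locale vector_endo = vector_space scale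
  for scale :: "'k::field \<Rightarrow> 'v::ab_group_add \<Rightarrow> 'v" (infixr \<open>*s\<close> 75) +
  fixes T :: "'v \<Rightarrow> 'v"
  assumes T_add: "T (x + y) = T x + T y"
    and T_scale: "T (a *s x) = a *s T x"
begin

text \<open>The vector \<open>p(T) x\<close>, by Horner's scheme. It makes the vector space a module over the polynomial ring.\<close>

definition act :: "'k poly \<Rightarrow> 'v \<Rightarrow> 'v" where
  "act p = fold_coeffs (\<lambda>a g x. a *s x + T (g x)) p (\<lambda>x. 0)"

lemma T_zero [simp]: "T 0 = 0"
  using T_scale[of 0 0] by simp

lemma act_0 [simp]: "act 0 x = 0"
  by (simp add: act_def)

lemma act_pCons [simp]: "act (pCons a p) x = a *s x + T (act p x)"
  by (cases "p = 0 \<and> a = 0") (auto simp: act_def)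

lemma act_1 [simp]: "act 1 x = x"
  by (simp add: one_pCons)

lemma act_add_right: "act p (x + y) = act p x + act p y"
  by (induction p) (simp_all add: scale_right_distrib T_add ac_simps)

lemma act_zero_right [simp]: "act p 0 = 0"
  by (induction p) simp_all

lemma act_add: "act (p + q) x = act p x + act q x"
  by (induction p q rule: poly_induct2) (simp_all add: scale_left_distrib T_add ac_simps)

lemma act_smult: "act (smult a p) x = a *s act p x"
  by (induction p) (simp_all add: scale_right_distrib T_scale)

lemma act_mult: "act (p * q) x = act p (act q x)"
  by (induction p) (simp_all add: act_add act_smult)

lemma act_diff: "act (p - q) x = act p x - act q x"
  using act_add[of "p - q" q x] by simp

lemma act_sum: "act p (\<Sum>i\<in>J. f i) = (\<Sum>i\<in>J. act p (f i))"
  by (induction J rule: infinite_finite_induct) (simp_all add: act_add_right)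

lemma act_sum_left: "act (\<Sum>i\<in>J. f i) x = (\<Sum>i\<in>J. act (f i) x)"
  by (induction J rule: infinite_finite_induct) (simp_all add: act_add)

lemma act_monom: "act (monom a n) x = a *s (T ^^ n) x"
proof (induction n)
  case (Suc n) then show ?case by (simp add: monom_Suc T_scale)
qed (simp add: monom_0)

lemma act_eq_sum_coeffs:
  assumes "\<And>i. i \<ge> n \<Longrightarrow> coeff r i = 0"
  shows "act r x = (\<Sum>i<n. coeff r i *s (T ^^ i) x)"
proof -
  have "r = (\<Sum>i<n. monom (coeff r i) i)"
    by (rule poly_eqI) (use assms in \<open>auto simp: coeff_sum intro: leI\<close>)
  then have "act r x = act (\<Sum>i<n. monom (coeff r i) i) x" by simp
  then show ?thesis by (simp only: act_sum_left act_monom)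
qed

text \<open>The submodule over the polynomial ring that is generated by the vectors \<open>v s\<close>.\<close>

definition poly_span :: "'s set \<Rightarrow> ('s \<Rightarrow> 'v) \<Rightarrow> 'v set" where
  "poly_span I v = range (\<lambda>r. \<Sum>s\<in>I. act (r s) (v s))"

text \<open>The submodule generated by the \<open>v s\<close> is the direct sum of the cyclic modules \<open>K[x]/(h s)\<close>: the last
  condition says that there are no relations between the generators besides those that hold for each
  generator separately.\<close>

definition cyclic_decomp :: "'s set \<Rightarrow> ('s \<Rightarrow> 'v) \<Rightarrow> ('s \<Rightarrow> 'k poly) \<Rightarrow> bool" where
  "cyclic_decomp I v h \<longleftrightarrow> finite I
     \<and> (\<forall>s\<in>I. monic (h s) \<and> act (h s) (v s) = 0)
     \<and> (\<forall>r. (\<Sum>s\<in>I. act (r s) (v s)) = 0 \<longrightarrow> (\<forall>s\<in>I. h s dvd r s))"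

lemma poly_spanI: "x = (\<Sum>s\<in>I. act (r s) (v s)) \<Longrightarrow> x \<in> poly_span I v"
  unfolding poly_span_def by (rule range_eqI[of _ _ r])

lemma subspace_poly_span: "subspace (poly_span I v)"
proof (rule subspaceI)
  have "(\<Sum>s\<in>I. act 0 (v s)) \<in> poly_span I v" unfolding poly_span_def by (rule rangeI)
  then show "0 \<in> poly_span I v" by simp
next
  fix x y assume "x \<in> poly_span I v" "y \<in> poly_span I v"
  then obtain r r' where "x = (\<Sum>s\<in>I. act (r s) (v s))" "y = (\<Sum>s\<in>I. act (r' s) (v s))"
    unfolding poly_span_def by auto
  then have "x + y = (\<Sum>s\<in>I. act (r s + r' s) (v s))"
    by (simp add: act_add sum.distrib)
  then show "x + y \<in> poly_span I v" by (rule poly_spanI)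
next
  fix c x assume "x \<in> poly_span I v"
  then obtain r where "x = (\<Sum>s\<in>I. act (r s) (v s))" unfolding poly_span_def by auto
  then have "c *s x = (\<Sum>s\<in>I. act (smult c (r s)) (v s))"
    by (simp add: act_smult scale_sum_right)
  then show "c *s x \<in> poly_span I v" by (rule poly_spanI)
qed

lemma act_poly_span: "x \<in> poly_span I v \<Longrightarrow> act p x \<in> poly_span I v"
  unfolding poly_span_def by (auto simp: act_sum act_mult[symmetric] intro!: range_eqI[OF refl])

lemma act_in_poly_span:
  assumes "finite I" "s \<in> I" shows "act p (v s) \<in> poly_span I v"
proof -
  have "act p (v s) = (\<Sum>t\<in>I. act (if t = s then p else 0) (v t))"
    using assms by (simp add: if_distrib[of "\<lambda>p. act p _"] sum.delta cong: if_cong)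
  then show ?thesis by (rule poly_spanI)
qed

lemma act_image_poly_span: "act p ` poly_span I v = poly_span I (\<lambda>s. act p (v s))"
proof -
  have "act p (\<Sum>s\<in>I. act (r s) (v s)) = (\<Sum>s\<in>I. act (r s) (act p (v s)))" for r
    by (simp add: act_sum act_mult[symmetric] mult.commute)
  then show ?thesis unfolding poly_span_def by (simp add: image_image)
qed

definition krylov_index :: "'s set \<Rightarrow> ('s \<Rightarrow> 'k poly) \<Rightarrow> ('s \<times> nat) set" where
  "krylov_index I h = (SIGMA s:I. {..<degree (h s)})"

definition krylov :: "('s \<Rightarrow> 'v) \<Rightarrow> 's \<times> nat \<Rightarrow> 'v" where
  "krylov v = (\<lambda>(s, i). (T ^^ i) (v s))"

lemma finite_krylov_index: "finite I \<Longrightarrow> finite (krylov_index I h)"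
  by (simp add: krylov_index_def)

lemma card_krylov_index: "finite I \<Longrightarrow> card (krylov_index I h) = (\<Sum>s\<in>I. degree (h s))"
  by (simp add: krylov_index_def)

lemma act_mod:
  assumes "act h x = 0" shows "act (r mod h) x = act r x"
proof -
  have "act r x = act (r div h * h + r mod h) x" by simp
  also have "\<dots> = act (r mod h) x" by (simp only: act_add act_mult assms) simp
  finally show ?thesis ..
qed

text \<open>Division with remainder by \<open>h s\<close> replaces a polynomial multiple of \<open>v s\<close> by a linear combination of the
  finitely many vectors \<open>T\<^sup>i v\<^sub>s\<close> with \<open>i < degree (h s)\<close>.\<close>

lemma sum_act_mod:
  assumes "finite I" "\<And>s. s \<in> I \<Longrightarrow> monic (h s) \<and> act (h s) (v s) = 0"
  shows "(\<Sum>s\<in>I. act (r s) (v s))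
    = (\<Sum>(s, i)\<in>krylov_index I h. coeff (r s mod h s) i *s krylov v (s, i))"
proof -
  have "(\<Sum>s\<in>I. act (r s) (v s))
      = (\<Sum>s\<in>I. \<Sum>i<degree (h s). coeff (r s mod h s) i *s (T ^^ i) (v s))"
    using assms(2) by (intro sum.cong refl) (simp add: act_eq_sum_coeffs[symmetric] coeff_mod_eq_0 act_mod)
  then show ?thesis
    using assms(1) by (simp add: krylov_def krylov_index_def sum.Sigma)
qed

lemma poly_span_eq_span_krylov:
  assumes "finite I" "\<And>s. s \<in> I \<Longrightarrow> monic (h s) \<and> act (h s) (v s) = 0"
  shows "poly_span I v = span (krylov v ` krylov_index I h)"
proof
  have "(\<Sum>s\<in>I. act (r s) (v s)) \<in> span (krylov v ` krylov_index I h)" for r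
    by (subst sum_act_mod[where h = h and v = v and r = r, OF assms])
      (auto intro!: span_sum span_scale intro: span_base)
  then show "poly_span I v \<subseteq> span (krylov v ` krylov_index I h)"
    unfolding poly_span_def by blast
  have "krylov v ` krylov_index I h \<subseteq> poly_span I v"
    using act_in_poly_span[OF assms(1), where p = "monom 1 _"]
    by (auto simp: krylov_def krylov_index_def act_monom)
  then show "span (krylov v ` krylov_index I h) \<subseteq> poly_span I v"
    by (rule span_minimal) (rule subspace_poly_span)
qed

lemma cyclic_decomp_annihilator_dvd:
  assumes dec: "cyclic_decomp I v h" and s: "s \<in> I" and p: "act p (v s) = 0"
  shows "h s dvd p"
proof -
  let ?r = "\<lambda>t. if t = s then p else 0"
  have "(\<Sum>t\<in>I. act (?r t) (v t)) = 0" using p by (intro sum.neutral) auto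
  then have "\<forall>t\<in>I. h t dvd ?r t"
    using dec unfolding cyclic_decomp_def by (elim conjE allE[of _ ?r]) blast
  then show ?thesis using s by force
qed

text \<open>A linear relation between the \<open>T\<^sup>i v\<^sub>s\<close> is a relation between the generators whose coefficients are
  polynomials of degree less than \<open>degree (h s)\<close>. Being divisible by \<open>h s\<close>, they vanish.\<close>

lemma cyclic_decomp_krylov_independent:
  assumes dec: "cyclic_decomp I v h"
  shows "inj_on (krylov v) (krylov_index I h)" "independent (krylov v ` krylov_index I h)"
proof -
  have fin: "finite I" using dec by (simp add: cyclic_decomp_def)
  have coeffs_zero: "u x = 0"
    if u: "(\<Sum>x\<in>krylov_index I h. u x *s krylov v x) = 0" and x: "x \<in> krylov_index I h" for u x
  proof -
    define r where "r s = (\<Sum>i<degree (h s). monom (u (s, i)) i)" for s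
    have cr: "coeff (r s) i = (if i < degree (h s) then u (s, i) else 0)" for s i
      by (simp add: r_def coeff_sum)
    have "(\<Sum>s\<in>I. act (r s) (v s)) = (\<Sum>s\<in>I. \<Sum>i<degree (h s). u (s, i) *s (T ^^ i) (v s))"
      by (simp add: r_def act_sum_left act_monom)
    also have "\<dots> = (\<Sum>x\<in>krylov_index I h. u x *s krylov v x)"
      using fin by (simp add: krylov_def krylov_index_def sum.Sigma case_prod_beta)
    finally have zero: "(\<Sum>s\<in>I. act (r s) (v s)) = 0" using u by simp
    obtain s i where si: "x = (s, i)" "s \<in> I" "i < degree (h s)"
      using x by (auto simp: krylov_index_def)
    have "h s dvd r s" using dec zero si by (auto simp: cyclic_decomp_def)
    moreover have "degree (r s) < degree (h s)"
      using si(3) cr[of s] by (metis leading_coeff_0_iff degree_0 gr_implies_not0 not_gr_zero)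
    ultimately have "r s = 0" using dvd_imp_degree_le leD by blast
    then show ?thesis using cr[of s i] si by simp
  qed
  show "inj_on (krylov v) (krylov_index I h)"
    by (rule independent_familyI(1)[OF finite_krylov_index[OF fin]]) (rule coeffs_zero)
  show "independent (krylov v ` krylov_index I h)"
    by (rule independent_familyI(2)[OF finite_krylov_index[OF fin]]) (rule coeffs_zero)
qed

lemma cyclic_decomp_dim:
  assumes dec: "cyclic_decomp I v h"
  shows "dim (poly_span I v) = (\<Sum>s\<in>I. degree (h s))"
proof -
  have fin: "finite I" and ann: "\<And>s. s \<in> I \<Longrightarrow> monic (h s) \<and> act (h s) (v s) = 0"
    using dec by (auto simp: cyclic_decomp_def)
  have "dim (poly_span I v) = card (krylov v ` krylov_index I h)"
    using cyclic_decomp_krylov_independent(2)[OF dec]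
      poly_span_eq_span_krylov[where v = v and h = h, OF fin ann]
    by (simp add: dim_eq_card_independent)
  then show ?thesis
    using cyclic_decomp_krylov_independent(1)[OF dec]
    by (simp add: card_image card_krylov_index[OF fin])
qed

text \<open>A family that spans a space and has as many members as its dimension is a basis. Thus for generators
  with known annihilating polynomials a count of dimensions replaces the proof that they are
  independent.\<close>

lemma cyclic_decomp_of_dim:
  assumes fin: "finite I" and ann: "\<And>s. s \<in> I \<Longrightarrow> monic (h s) \<and> act (h s) (v s) = 0"
    and dim: "(\<Sum>s\<in>I. degree (h s)) \<le> dim (poly_span I v)"
  shows "cyclic_decomp I v h"
  unfolding cyclic_decomp_def
proof (intro conjI ballI allI impI)
  fix r s assume zero: "(\<Sum>s\<in>I. act (r s) (v s)) = 0" and s: "s \<in> I"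
  let ?u = "\<lambda>(s, i). coeff (r s mod h s) i"
  have "card (krylov_index I h) \<le> dim (span (krylov v ` krylov_index I h))"
    using dim by (simp only: card_krylov_index[OF fin] poly_span_eq_span_krylov[OF fin ann])
  moreover have "(\<Sum>x\<in>krylov_index I h. ?u x *s krylov v x) = 0"
    using zero sum_act_mod[where h = h and v = v and r = r, OF fin ann]
    by (simp add: case_prod_beta)
  ultimately have u: "?u x = 0" if "x \<in> krylov_index I h" for x
    by (rule family_zero_coeffs[OF finite_krylov_index[OF fin]]) (rule that)
  have "coeff (r s mod h s) i = 0" for i
    using u[of "(s, i)"] coeff_mod_eq_0[of "h s" i "r s"] ann[OF s] s
    by (cases "i < degree (h s)") (auto simp: krylov_index_def)
  then have "r s mod h s = 0" by (intro poly_eqI) simp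
  then show "h s dvd r s" by auto
qed (use fin ann in auto)

lemma cyclic_decomp_strip_factor:
  assumes dec: "cyclic_decomp I v h" and p: "prime_elem p" "monic p"
  shows "cyclic_decomp I (\<lambda>s. act p (v s)) (\<lambda>s. strip_factor p (h s))"
  unfolding cyclic_decomp_def
proof (intro conjI ballI allI impI)
  fix s assume s: "s \<in> I"
  show "monic (strip_factor p (h s))"
    using dec s p by (simp add: cyclic_decomp_def strip_factor_monic)
  have "h s dvd strip_factor p (h s) * p"
    by (simp add: strip_factor_def)
  then obtain t where "strip_factor p (h s) * p = t * h s" by (metis dvdE mult.commute)
  then have "act (strip_factor p (h s)) (act p (v s)) = act t (act (h s) (v s))"
    by (metis act_mult)
  then show "act (strip_factor p (h s)) (act p (v s)) = 0"
    using dec s by (simp add: cyclic_decomp_def)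
next
  fix r s assume zero: "(\<Sum>s\<in>I. act (r s) (act p (v s))) = 0" and s: "s \<in> I"
  have "(\<Sum>s\<in>I. act (r s * p) (v s)) = 0" using zero by (simp add: act_mult)
  then have "h s dvd r s * p" using dec s unfolding cyclic_decomp_def by (elim conjE allE[of _ "\<lambda>s. r s * p"]) blast
  then show "strip_factor p (h s) dvd r s" by (rule strip_factor_dvd[OF p(1)])
qed (use dec in \<open>simp add: cyclic_decomp_def\<close>)

text \<open>A summand \<open>K[x]/(h)\<close> shrinks under \<open>p\<close> to \<open>K[x]/(h/p)\<close> when \<open>p\<close> divides \<open>h\<close>, and is mapped
  onto itself otherwise.\<close>

lemma cyclic_decomp_dim_strip_factor:
  assumes dec: "cyclic_decomp I v h" and p: "prime_elem p" "monic p"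
  shows "dim (poly_span I v) = dim (act p ` poly_span I v) + card {s \<in> I. p dvd h s} * degree p"
  unfolding act_image_poly_span cyclic_decomp_dim[OF dec] cyclic_decomp_dim[OF cyclic_decomp_strip_factor[OF dec p]]
  using dec p(2) by (intro sum_degree_strip_factor) (auto simp: cyclic_decomp_def)

text \<open>The dimensions of the module and of its image under \<open>p\<close> do not depend on the decomposition.\<close>

lemma cyclic_decomp_card_dvd_unique:
  assumes dec: "cyclic_decomp I v h" "cyclic_decomp I' v' h'" and poly_span: "poly_span I v = poly_span I' v'"
    and p: "prime_elem p" "monic p"
  shows "card {s \<in> I. p dvd h s} = card {s \<in> I'. p dvd h' s}"
  using cyclic_decomp_dim_strip_factor[OF dec(1) p] cyclic_decomp_dim_strip_factor[OF dec(2) p]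
    prime_elem_degree_pos[OF p(1)]
  by (simp add: poly_span)

text \<open>The product of the annihilators of all summands is the characteristic polynomial of \<open>T\<close> on the module,
  and so does not depend on the decomposition. A prime factor \<open>p\<close> of some \<open>h s\<close>
  divides equally many terms on both sides; passing to the image under \<open>p\<close> removes one factor \<open>p\<close> from each of them,
  so induction on the sum of the degrees applies. When every summand is repeated \<open>a\<close> times, both counts are
  multiplied by \<open>a\<close>, which cancels. So the products over \<open>I\<close> and \<open>I'\<close> themselves agree, not
  just their \<open>a\<close>-th powers.\<close>

lemma cyclic_decomp_prod_unique:
  fixes a :: nat
  assumes a: "a > 0" and fin: "finite I" "finite I'"
    and "cyclic_decomp (I \<times> {..<a}) v (\<lambda>(s, c). h s)"
    and "cyclic_decomp (I' \<times> {..<a}) v' (\<lambda>(s, c). h' s)"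
    and "poly_span (I \<times> {..<a}) v = poly_span (I' \<times> {..<a}) v'"
  shows "prod h I = prod h' I'"
  using assms(4-)
proof (induction "\<Sum>s\<in>I. degree (h s)" arbitrary: v h v' h' rule: less_induct)
  case less
  let ?J = "I \<times> {..<a}" and ?J' = "I' \<times> {..<a}"
  have mon: "monic (h s)" if "s \<in> I" for s
    using less.prems(1) that a by (force simp: cyclic_decomp_def)
  have mon': "monic (h' s)" if "s \<in> I'" for s
    using less.prems(2) that a by (force simp: cyclic_decomp_def)
  have card_times: "card {x \<in> K \<times> {..<a}. P (fst x)} = card {s \<in> K. P s} * a"
    for K :: "'z set" and P
  proof -
    have "{x \<in> K \<times> {..<a}. P (fst x)} = {s \<in> K. P s} \<times> {..<a}" by auto
    then show ?thesis by (simp only: card_cartesian_product card_lessThan)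
  qed
  show ?case
  proof (cases "\<exists>s\<in>I. degree (h s) > 0")
    case True
    then obtain t where t: "t \<in> I" "degree (h t) > 0" by auto
    from irreducible_monic_factor[OF t(2)] obtain p q
      where p: "irreducible p" "h t = p * q" "monic p" by auto
    have prime: "prime_elem p" by (rule field_poly_irreducible_imp_prime[OF p(1)])
    have split: "card {x \<in> ?J. p dvd (case x of (s, c) \<Rightarrow> h s)} = card {s \<in> I. p dvd h s} * a"
      "card {x \<in> ?J'. p dvd (case x of (s, c) \<Rightarrow> h' s)} = card {s \<in> I'. p dvd h' s} * a"
      using card_times[of I "\<lambda>s. p dvd h s"] card_times[of I' "\<lambda>s. p dvd h' s"]
      by (simp_all add: case_prod_beta)
    have cnt: "card {s \<in> I. p dvd h s} = card {s \<in> I'. p dvd h' s}"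
      using cyclic_decomp_card_dvd_unique[OF less.prems prime p(3)] a unfolding split by simp
    have "(\<Sum>s\<in>I. degree (strip_factor p (h s))) < (\<Sum>s\<in>I. degree (h s))"
    proof -
      have "card {s \<in> I. p dvd h s} > 0" using t p fin by (auto simp: card_gt_0_iff)
      then show ?thesis
        using sum_degree_strip_factor[of I p h] fin p mon prime_elem_degree_pos[OF prime] by simp
    qed
    moreover have "cyclic_decomp ?J (\<lambda>x. act p (v x)) (\<lambda>(s, c). strip_factor p (h s))"
      "cyclic_decomp ?J' (\<lambda>x. act p (v' x)) (\<lambda>(s, c). strip_factor p (h' s))"
      using cyclic_decomp_strip_factor[OF less.prems(1) prime p(3)]
        cyclic_decomp_strip_factor[OF less.prems(2) prime p(3)]
      by (simp_all add: case_prod_beta')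
    moreover have "poly_span ?J (\<lambda>x. act p (v x)) = poly_span ?J' (\<lambda>x. act p (v' x))"
      unfolding act_image_poly_span[symmetric] less.prems(3) ..
    ultimately have "prod (\<lambda>s. strip_factor p (h s)) I = prod (\<lambda>s. strip_factor p (h' s)) I'"
      by (rule less.hyps)
    then show ?thesis
      unfolding prod_strip_factor[OF fin(1) p(3), of h] prod_strip_factor[OF fin(2) p(3), of h']
      by (simp add: cnt)
  next
    case False
    then have "dim (poly_span ?J' v') = 0"
      using cyclic_decomp_dim[OF less.prems(1)] less.prems(3)
      by (auto simp: case_prod_beta intro!: sum.neutral)
    then have "\<forall>x\<in>?J'. degree (h' (fst x)) = 0"
      using cyclic_decomp_dim[OF less.prems(2)] fin by (simp add: case_prod_beta)
    then have "\<forall>s\<in>I'. degree (h' s) = 0" using a by force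
    then show ?thesis
      using False mon mon' by (simp add: monic_degree_0)
  qed
qed

end


section \<open>A division algebra over the subfield generated by an element\<close>

locale division_algebra_element =
  fixes \<iota> :: "'f::field \<Rightarrow> 'd::division_ring" and d :: nat and z :: 'd
  assumes central: "central_division_algebra \<iota>"
    and degree: "has_degree \<iota> d"
    and d_pos: "d > 0"
begin

sublocale \<iota>: Ring_Hom.ring_hom \<iota>
  using central by (simp add: central_division_algebra_def)

lemma \<iota>_commute: "\<iota> a * x = x * \<iota> a"
  using central unfolding central_division_algebra_def center_def by (metis (mono_tags, lifting) mem_Collect_eq rangeI)

sublocale vector_endo "\<lambda>a x. \<iota> a * x" "\<lambda>x. z * x"
proof unfold_locales
  show "z * (\<iota> a * x) = \<iota> a * (z * x)" for a x
    by (metis \<iota>_commute mult.assoc)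
qed (simp_all add: algebra_simps \<iota>.hom_add \<iota>.hom_mult)

lemma act_mult_right: "act p (x * y) = act p x * y"
  by (induction p) (simp_all add: algebra_simps)

lemma act_eq_act_1_mult: "act p y = act p 1 * y"
  using act_mult_right[of p 1 y] by simp

text \<open>The dimension of an infinite-dimensional space is \<open>0\<close> by convention, which \<open>d > 0\<close> excludes.\<close>

lemma finite_basis:
  obtains B where "finite B" "card B = d\<^sup>2" "span B = UNIV" "independent B"
proof -
  obtain B where B: "independent B" "UNIV \<subseteq> span B" "card B = dim UNIV"
    by (rule basis_exists[of UNIV])
  have "card B = d\<^sup>2" using B(3) degree by (simp add: has_degree_def)
  moreover from this have "finite B" using d_pos by (intro card_ge_0_finite) simp
  ultimately show ?thesis using that B by auto
qed

lemma dim_le: "dim S \<le> d\<^sup>2"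
proof -
  obtain B where "finite B" "card B = d\<^sup>2" "span B = UNIV" by (rule finite_basis)
  then show ?thesis using dim_le_card[of S B] by simp
qed

lemma ex_annihilating_poly: "\<exists>p. p \<noteq> 0 \<and> act p 1 = 0"
proof (rule ccontr)
  assume no: "\<not> ?thesis"
  let ?J = "{..d\<^sup>2}" and ?w = "\<lambda>i. ((\<lambda>x. z * x) ^^ i) 1"
  have zero: "u i = 0" if u: "(\<Sum>i\<in>?J. \<iota> (u i) * ?w i) = 0" and i: "i \<in> ?J" for u i
  proof -
    let ?p = "\<Sum>i\<in>?J. monom (u i) i"
    have "act ?p 1 = 0" using u by (simp add: act_sum_left act_monom)
    then have "?p = 0" using no by blast
    then have "coeff ?p i = 0" by simp
    then show ?thesis using i by (simp add: coeff_sum)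
  qed
  have inj: "inj_on ?w ?J" and ind: "independent (?w ` ?J)"
    by (rule independent_familyI; simp add: zero)+
  have "card (?w ` ?J) = dim (?w ` ?J)" using ind by (simp add: dim_eq_card_independent)
  also have "\<dots> \<le> d\<^sup>2" by (rule dim_le)
  finally show False using inj by (simp add: card_image)
qed

lemma minimal_poly_exists:
  obtains f where "monic f" "act f 1 = 0" "\<And>q. act q 1 = 0 \<Longrightarrow> f dvd q"
proof -
  let ?P = "\<lambda>p. p \<noteq> 0 \<and> act p 1 = 0"
  obtain p where p: "?P p" and least: "\<And>q. ?P q \<Longrightarrow> degree p \<le> degree q"
    using ex_has_least_nat[where P = ?P and m = degree] ex_annihilating_poly by blast
  define f where "f = smult (inverse (lead_coeff p)) p"
  have mon: "monic f" using p by (simp add: f_def)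
  have ann: "act f 1 = 0" using p by (simp add: f_def act_smult)
  have "f dvd q" if q: "act q 1 = 0" for q
  proof (rule ccontr)
    assume "\<not> f dvd q"
    then have nz: "q mod f \<noteq> 0" by (simp add: mod_eq_0_iff_dvd)
    have "f \<noteq> 0" using mon by auto
    then have "degree (q mod f) < degree f" using nz by (intro degree_mod_less') auto
    moreover have "degree p \<le> degree (q mod f)"
      using nz q by (intro least) (simp add: act_mod[OF ann])
    ultimately show False using p by (simp add: f_def)
  qed
  with mon ann show ?thesis by (rule that)
qed

text \<open>The elements \<open>r(z)\<close> form a field. The remainder \<open>r'\<close> of \<open>f\<close> modulo \<open>r\<close> satisfies
  \<open>r'(z) = - q(z) r(z)\<close> with a quotient \<open>q\<close> of smaller degree than \<open>f\<close>, so \<open>r'(z)\<close> is again nonzero, and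
  an inverse of it yields one of \<open>r(z)\<close>.\<close>

lemma act_inverse_exists:
  assumes f: "act f 1 = 0" "\<And>q. act q 1 = 0 \<Longrightarrow> f dvd q" "monic f"
    and r: "act r 1 \<noteq> 0"
  obtains s where "act (s * r) 1 = 1"
proof -
  have f0: "f \<noteq> 0" using f(3) by auto
  have small: "\<exists>s. act (s * r) 1 = 1" if "act r 1 \<noteq> 0" "degree r < degree f" for r
    using that
  proof (induction "degree r" arbitrary: r rule: less_induct)
    case less
    show ?case
    proof (cases "degree r = 0")
      case True
      then obtain c where c: "r = [:c:]" by (rule degree_eq_zeroE)
      then have "c \<noteq> 0" using less.prems by auto
      then have "[:inverse c:] * r = 1" by (simp add: c one_pCons)
      then show ?thesis by (metis act_1)
    next
      case False
      define q r' where "q = f div r" and "r' = f mod r"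
      have eq: "f = q * r + r'" by (simp add: q_def r'_def)
      have r0: "r \<noteq> 0" using False by auto
      have deg_r': "r' = 0 \<or> degree r' < degree r"
        unfolding r'_def using r0 by (metis degree_mod_less)
      have "q \<noteq> 0" using eq deg_r' less.prems(2) f0 by auto
      have "degree f = degree q + degree r"
        using eq deg_r' \<open>q \<noteq> 0\<close> r0
        by (metis degree_add_eq_left degree_mult_eq add.right_neutral le_add2 less_le_trans)
      then have "degree q < degree f" using False by simp
      then have q1: "act q 1 \<noteq> 0" using f(2)[of q] \<open>q \<noteq> 0\<close> dvd_imp_degree_le leD by blast
      have "act r' 1 = - (act q 1 * act r 1)"
        using f(1) eq act_eq_act_1_mult[of q "act r 1"]
        by (simp add: act_add act_mult eq_neg_iff_add_eq_0 add.commute)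
      then have r'1: "act r' 1 \<noteq> 0" using q1 less.prems(1) by simp
      then have "r' \<noteq> 0" by auto
      with deg_r' have "degree r' < degree r" by simp
      with less.hyps[OF this r'1] less.prems(2) obtain s where s: "act (s * r') 1 = 1" by auto
      have "(- s * q) * r = s * r' - s * f" unfolding eq by (simp add: algebra_simps)
      then have "act ((- s * q) * r) 1 = 1" using s f(1) by (simp only: act_diff) (simp add: act_mult)
      then show ?thesis by blast
    qed
  qed
  have "act (r mod f) 1 \<noteq> 0" using r by (simp add: act_mod[OF f(1)])
  moreover from this have "r mod f \<noteq> 0" by auto
  then have "degree (r mod f) < degree f" using f0 by (intro degree_mod_less') auto
  ultimately obtain s where "act (s * (r mod f)) 1 = 1" using small by blast
  then have "act (s * r) 1 = 1" by (simp add: act_mult act_mod[OF f(1)])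
  then show ?thesis by (rule that)
qed

text \<open>A finite set \<open>B\<close> that is linearly independent over \<open>F(z)\<close> and as large as possible is a basis of \<open>D\<close>
  over \<open>F(z)\<close>: if \<open>y\<close> is not in its span, a nonzero \<open>r(z)\<close> cannot bring \<open>y\<close> into the span either, since
  \<open>r(z)\<close> has an inverse in \<open>F(z)\<close>, and so \<open>y\<close> could be added to \<open>B\<close>.\<close>

theorem free_over_generated_subfield:
  obtains f B where "monic f" "act f 1 = 0" "\<And>q. act q 1 = 0 \<Longrightarrow> f dvd q"
    "cyclic_decomp B (\<lambda>b. b) (\<lambda>_. f)" "poly_span B (\<lambda>b. b) = UNIV" "card B * degree f = d\<^sup>2"
proof -
  obtain f where f: "monic f" "act f 1 = 0" "\<And>q. act q 1 = 0 \<Longrightarrow> f dvd q"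
    by (rule minimal_poly_exists) blast
  have deg: "degree f > 0"
    using f(1,2) monic_degree_0[of f] by (cases "degree f = 0") auto
  have ann: "act f b = 0" for b using act_eq_act_1_mult[of f b] f(2) by simp
  define P where "P B \<longleftrightarrow> cyclic_decomp B (\<lambda>b. b) (\<lambda>_. f)" for B
  have card: "card B * degree f = dim (poly_span B (\<lambda>b. b))" if "P B" for B
    using cyclic_decomp_dim that unfolding P_def by fastforce
  have bound: "card B \<le> d\<^sup>2" if "P B" for B
  proof -
    have "card B * 1 \<le> card B * degree f" using deg by (intro mult_left_mono) auto
    then show ?thesis using card[OF that] dim_le[of "poly_span B (\<lambda>b. b)"] by simp
  qed
  have "P {}" by (simp add: P_def cyclic_decomp_def)
  obtain B where B: "P B" and max: "\<And>B'. P B' \<Longrightarrow> card B' \<le> card B"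
    using ex_has_greatest_nat[where P = P and f = card and b = "Suc (d\<^sup>2)"] \<open>P {}\<close> bound
    by (metis less_Suc_eq_le)
  have fin: "finite B" using B by (simp add: P_def cyclic_decomp_def)
  have full: "poly_span B (\<lambda>b. b) = UNIV"
  proof (rule ccontr)
    assume "poly_span B (\<lambda>b. b) \<noteq> UNIV"
    then obtain y where y: "y \<notin> poly_span B (\<lambda>b. b)" by auto
    have yB: "y \<notin> B" using y act_in_poly_span[OF fin, of y 1 "\<lambda>b. b"] by auto
    \<comment> \<open>A larger independent set contradicts the choice of \<open>B\<close>.\<close>
    have "P (insert y B)"
      unfolding P_def cyclic_decomp_def
    proof (intro conjI allI impI)
      fix r assume zero: "(\<Sum>s\<in>insert y B. act (r s) s) = 0"
      then have sum: "act (r y) y = - (\<Sum>s\<in>B. act (r s) s)"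
        using fin yB by (simp add: eq_neg_iff_add_eq_0)
      have ry: "act (r y) 1 = 0"
      proof (rule ccontr)
        assume "act (r y) 1 \<noteq> 0"
        then obtain s where s: "act (s * r y) 1 = 1"
          using act_inverse_exists f by metis
        have "y = act (s * r y) y" using s act_eq_act_1_mult[of "s * r y" y] by simp
        also have "\<dots> = act s (- (\<Sum>s\<in>B. act (r s) s))" by (simp add: act_mult sum)
        also have "\<dots> \<in> poly_span B (\<lambda>b. b)"
          by (intro act_poly_span subspace_neg subspace_poly_span poly_spanI[OF refl])
        finally show False using y by simp
      qed
      then have "(\<Sum>s\<in>B. act (r s) s) = 0"
        using sum act_eq_act_1_mult[of "r y" y] by simp
      then have "\<forall>s\<in>B. f dvd r s" using B by (auto simp: P_def cyclic_decomp_def)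
      then show "\<forall>s\<in>insert y B. f dvd r s" using f(3)[OF ry] by simp
    qed (use fin f ann in auto)
    from max[OF this] show False using fin yB by simp
  qed
  have "card B * degree f = d\<^sup>2"
    using card[OF B] degree by (simp add: full has_degree_def)
  with f B full that show ?thesis unfolding P_def by blast
qed

end


section \<open>Square matrices as vectors\<close>

text \<open>A \<open>d \<times> d\<close> matrix is regarded as a vector by means of the function of its entries, which is extended by
  \<open>0\<close> to all pairs of indices. Functions form an additive group as a type, whereas the type of matrices
  contains the matrices of all sizes.\<close>

type_synonym 'k entries = "nat \<times> nat \<Rightarrow> 'k"

definition scale_entries :: "'k::field \<Rightarrow> 'k entries \<Rightarrow> 'k entries" where
  "scale_entries a x = (\<lambda>i. a * x i)"

definition entries :: "nat \<Rightarrow> 'k::field mat \<Rightarrow> 'k entries" where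
  "entries d X = (\<lambda>(i, c). if i < d \<and> c < d then X $$ (i, c) else 0)"

definition left_mult :: "nat \<Rightarrow> 'k::field mat \<Rightarrow> 'k entries \<Rightarrow> 'k entries" where
  "left_mult d A x = (\<lambda>(i, c). if i < d \<and> c < d then \<Sum>l<d. A $$ (i, l) * x (l, c) else 0)"

definition unit_entry :: "nat \<times> nat \<Rightarrow> 'k::field entries" where
  "unit_entry q = (\<lambda>i. if i = q then 1 else 0)"

definition square_entries :: "nat \<Rightarrow> 'k::field entries set" where
  "square_entries d = entries d ` carrier_mat d d"

interpretation entries: vector_space "scale_entries :: 'k::field \<Rightarrow> _"
  by unfold_locales (simp_all add: scale_entries_def fun_eq_iff algebra_simps)

lemma entries_eq_zero_iff:
  assumes "X \<in> carrier_mat d d" shows "entries d X = 0 \<longleftrightarrow> X = 0\<^sub>m d d"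
proof
  assume "entries d X = 0"
  then have zero: "entries d X (i, c) = 0" for i c by simp
  have "X $$ (i, c) = 0" if "i < d" "c < d" for i c
  proof -
    have "entries d X (i, c) = X $$ (i, c)" using that by (simp add: entries_def)
    then show ?thesis by (simp only: zero)
  qed
  then show "X = 0\<^sub>m d d" using assms by (intro eq_matI) auto
qed (auto simp: entries_def fun_eq_iff)

lemma entries_zero: "entries d (0\<^sub>m d d) = 0"
  using entries_eq_zero_iff[of "0\<^sub>m d d" d] by simp

lemma entries_add:
  assumes "X \<in> carrier_mat d d" "Y \<in> carrier_mat d d"
  shows "entries d (X + Y) = entries d X + entries d Y"
  using assms by (auto simp: entries_def fun_eq_iff)

lemma entries_smult:
  assumes "X \<in> carrier_mat d d"
  shows "entries d (a \<cdot>\<^sub>m X) = scale_entries a (entries d X)"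
  using assms by (auto simp: entries_def scale_entries_def fun_eq_iff)

lemma entries_mult:
  assumes "A \<in> carrier_mat d d" "X \<in> carrier_mat d d"
  shows "entries d (A * X) = left_mult d A (entries d X)"
  using assms
  by (auto simp: entries_def left_mult_def fun_eq_iff scalar_prod_def atLeast0LessThan intro!: sum.cong)

lemma square_entries_iff:
  "x \<in> square_entries d \<longleftrightarrow> (\<forall>i c. \<not> (i < d \<and> c < d) \<longrightarrow> x (i, c) = 0)"
proof
  assume "\<forall>i c. \<not> (i < d \<and> c < d) \<longrightarrow> x (i, c) = 0"
  then have "x = entries d (mat d d x)" by (auto simp: entries_def fun_eq_iff)
  then show "x \<in> square_entries d" unfolding square_entries_def by (intro image_eqI) auto
qed (auto simp: square_entries_def entries_def)

lemma subspace_square_entries: "entries.subspace (square_entries d)"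
  by (rule entries.subspaceI) (auto simp: square_entries_iff scale_entries_def)

lemma unit_entry_square: "i < d \<Longrightarrow> c < d \<Longrightarrow> unit_entry (i, c) \<in> square_entries d"
  by (auto simp: square_entries_iff unit_entry_def)

lemma sum_entries_apply: "(\<Sum>a\<in>S. f a :: 'k::field entries) p = (\<Sum>a\<in>S. f a p)"
  by (induction S rule: infinite_finite_induct) simp_all

lemma square_entries_expand:
  assumes "x \<in> square_entries d"
  shows "x = (\<Sum>q\<in>{..<d} \<times> {..<d}. scale_entries (x q) (unit_entry q))"
proof
  fix p
  have "(\<Sum>q\<in>{..<d} \<times> {..<d}. scale_entries (x q) (unit_entry q)) p
      = (\<Sum>q\<in>{..<d} \<times> {..<d}. scale_entries (x q) (unit_entry q) p)"
    by (rule sum_entries_apply)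
  also have "\<dots> = (\<Sum>q\<in>{..<d} \<times> {..<d}. if p = q then x q else 0)"
    by (intro sum.cong) (auto simp: scale_entries_def unit_entry_def)
  also have "\<dots> = x p"
    using assms by (cases p) (auto simp: sum.delta' square_entries_iff)
  finally show "x p = (\<Sum>q\<in>{..<d} \<times> {..<d}. scale_entries (x q) (unit_entry q)) p" ..
qed

lemma dim_square_entries: "entries.dim (square_entries d :: 'k::field entries set) = d\<^sup>2"
proof -
  let ?J = "{..<d} \<times> {..<d}" and ?E = "unit_entry :: _ \<Rightarrow> 'k entries"
  have zero: "u q = 0"
    if u: "(\<Sum>q\<in>?J. scale_entries (u q) (?E q)) = 0" and q: "q \<in> ?J" for u q
  proof -
    have "0 = (\<Sum>q\<in>?J. scale_entries (u q) (?E q)) q" by (simp add: u)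
    also have "\<dots> = (\<Sum>p\<in>?J. if q = p then u p else 0)"
      unfolding sum_entries_apply by (intro sum.cong) (auto simp: scale_entries_def unit_entry_def)
    also have "\<dots> = u q" using q by (simp add: sum.delta')
    finally show ?thesis by simp
  qed
  have inj: "inj_on ?E ?J"
    by (rule entries.independent_familyI(1)) (auto intro: zero)
  have ind: "entries.independent (?E ` ?J)"
    by (rule entries.independent_familyI(2)) (auto intro: zero)
  show ?thesis
  proof (rule entries.dim_unique[OF _ _ ind])
    show "?E ` ?J \<subseteq> square_entries d" by (auto intro: unit_entry_square)
    show "square_entries d \<subseteq> entries.span (?E ` ?J)"
    proof
      fix x :: "'k entries" assume "x \<in> square_entries d"
      then have "x = (\<Sum>q\<in>?J. scale_entries (x q) (?E q))" by (rule square_entries_expand)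
      also have "\<dots> \<in> entries.span (?E ` ?J)"
        by (intro entries.span_sum entries.span_scale entries.span_base imageI)
      finally show "x \<in> entries.span (?E ` ?J)" .
    qed
    show "card (?E ` ?J) = d\<^sup>2" by (simp add: card_image[OF inj] power2_eq_square)
  qed
qed

lemma vector_endo_left_mult: "vector_endo scale_entries (left_mult d A)"
proof (intro vector_endo.intro vector_endo_axioms.intro entries.vector_space_axioms)
  show "left_mult d A (x + y) = left_mult d A x + left_mult d A y" for x y
    by (auto simp: left_mult_def fun_eq_iff distrib_left sum.distrib)
  show "left_mult d A (scale_entries a x) = scale_entries a (left_mult d A x)" for a x
    by (auto simp: left_mult_def scale_entries_def fun_eq_iff sum_distrib_left mult.left_commute)
qed

lemma act_left_mult_square:
  assumes "x \<in> square_entries d"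
  shows "vector_endo.act scale_entries (left_mult d A) p x \<in> square_entries d"
proof -
  interpret vector_endo scale_entries "left_mult d A" by (rule vector_endo_left_mult)
  show ?thesis
  proof (induction p)
    case 0
    then show ?case by (simp add: square_entries_iff)
  next
    case (pCons a p)
    have "scale_entries a x \<in> square_entries d"
      by (rule entries.subspace_scale[OF subspace_square_entries assms])
    moreover have "left_mult d A (act p x) \<in> square_entries d"
      by (auto simp: left_mult_def square_entries_iff)
    ultimately show ?case
      unfolding act_pCons by (rule entries.subspace_add[OF subspace_square_entries])
  qed
qed

lemma poly_span_left_mult_square:
  assumes "\<And>s. s \<in> I \<Longrightarrow> v s \<in> square_entries d"
  shows "vector_endo.poly_span scale_entries (left_mult d A) I v \<subseteq> square_entries d"
proof -
  interpret vector_endo scale_entries "left_mult d A" by (rule vector_endo_left_mult)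
  have "(\<Sum>s\<in>I. act (r s) (v s)) \<in> square_entries d" for r
    by (rule entries.subspace_sum[OF subspace_square_entries])
      (rule act_left_mult_square[OF assms])
  then show ?thesis unfolding poly_span_def by blast
qed


section \<open>Monomial matrices as direct sums of cyclic modules\<close>

context
  fixes d :: nat and \<sigma> :: "nat \<Rightarrow> nat"
  assumes perm: "\<sigma> permutes {..<d}"
begin

lemma cycle_subset: "C \<in> cycles d \<sigma> \<Longrightarrow> C \<subseteq> {..<d}"
  unfolding cycles_def using permutes_orbit_subset[OF perm] by (elim imageE) simp

lemma finite_cycle: "C \<in> cycles d \<sigma> \<Longrightarrow> finite C"
  by (rule finite_subset[OF cycle_subset]) simp_all

lemma finite_cycles: "finite (cycles d \<sigma>)"
  by (simp add: cycles_def)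

lemma cycle_nonempty: "C \<in> cycles d \<sigma> \<Longrightarrow> C \<noteq> {}"
  by (auto simp: cycles_def intro: orbit.base)

lemma orbit_eq_cycle: "C \<in> cycles d \<sigma> \<Longrightarrow> x \<in> C \<Longrightarrow> orbit \<sigma> x = C"
  unfolding cycles_def
  by (elim imageE, hypsubst, rule orbit_cyclic_eq3[OF cyclic_on_orbit[OF perm finite_lessThan]])

lemma permutation_perm: "permutation \<sigma>"
  by (rule permutes_imp_permutation[OF finite_lessThan perm])

lemma Union_cycles: "\<Union> (cycles d \<sigma>) = {..<d}"
proof
  show "{..<d} \<subseteq> \<Union> (cycles d \<sigma>)"
    using permutation_self_in_orbit[OF permutation_perm]
    by (auto simp: cycles_def lessThan_atLeast0)
qed (use cycle_subset in blast)

lemma sum_card_cycles: "(\<Sum>C\<in>cycles d \<sigma>. card C) = d"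
proof -
  have "card (\<Union> (cycles d \<sigma>)) = (\<Sum>C\<in>cycles d \<sigma>. card C)"
  proof (rule card_Union_disjoint)
    show "pairwise disjnt (cycles d \<sigma>)"
      unfolding pairwise_def disjnt_def by (metis orbit_eq_cycle disjoint_iff)
  qed (use finite_cycle in blast)
  then show ?thesis by (simp add: Union_cycles)
qed

lemma cycle_eq_funpow: "C \<in> cycles d \<sigma> \<Longrightarrow> x \<in> C \<Longrightarrow> C = {(\<sigma> ^^ n) x |n. True}"
  using orbit_altdef_permutation[OF permutation_perm] orbit_eq_cycle by simp

lemma funpow_card_cycle:
  assumes "C \<in> cycles d \<sigma>" "x \<in> C"
  shows "(\<sigma> ^^ card C) x = x"
proof -
  have x: "x \<in> orbit \<sigma> x" by (rule permutation_self_in_orbit[OF permutation_perm])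
  have eq: "card C = funpow_dist1 \<sigma> x x"
    using orbit_conv_funpow_dist1[OF x] card_image[OF inj_on_funpow_dist1[OF x]]
      orbit_eq_cycle[OF assms] by (metis card_atLeastLessThan diff_zero)
  show ?thesis unfolding eq by (rule funpow_dist1_prop[OF x])
qed

lemma card_cycle_le:
  assumes "C \<in> cycles d \<sigma>" "x \<in> C" "(\<sigma> ^^ n) x = x" "n > 0"
  shows "card C \<le> n"
proof -
  have "C = (\<lambda>m. (\<sigma> ^^ m) x) ` {..<n}"
    using orbit_altdef_bounded[OF assms(3,4)] orbit_eq_cycle[OF assms(1,2)] by auto
  then show ?thesis using card_image_le[of "{..<n}" "\<lambda>m. (\<sigma> ^^ m) x"] by simp
qed

end

locale monomial_matrix =
  fixes d :: nat and A :: "'k::field mat" and \<sigma> :: "nat \<Rightarrow> nat"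
  assumes carrier: "A \<in> carrier_mat d d"
    and perm: "\<sigma> permutes {..<d}"
    and nonzero: "l < d \<Longrightarrow> A $$ (\<sigma> l, l) \<noteq> 0"
    and zero: "i < d \<Longrightarrow> l < d \<Longrightarrow> i \<noteq> \<sigma> l \<Longrightarrow> A $$ (i, l) = 0"
begin

sublocale vector_endo scale_entries "left_mult d A"
  by (rule vector_endo_left_mult)

lemma funpow_less: "l < d \<Longrightarrow> (\<sigma> ^^ n) l < d"
  using permutes_in_image[OF perm] by (induction n) auto

lemma left_mult_unit_entry:
  assumes "l < d" "c < d"
  shows "left_mult d A (unit_entry (l, c)) = scale_entries (A $$ (\<sigma> l, l)) (unit_entry (\<sigma> l, c))"
proof
  fix p :: "nat \<times> nat"
  obtain i e where p: "p = (i, e)" by (cases p)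
  have "\<sigma> l < d" using funpow_less[OF assms(1), of 1] by simp
  have "(\<Sum>m<d. A $$ (i, m) * unit_entry (l, c) (m, e)) = (\<Sum>m<d. if m = l then A $$ (i, l) * (if e = c then 1 else 0) else 0)"
    by (rule sum.cong) (auto simp: unit_entry_def)
  also have "\<dots> = A $$ (i, l) * (if e = c then 1 else 0)"
    using assms by (simp add: sum.delta)
  finally show "left_mult d A (unit_entry (l, c)) p = scale_entries (A $$ (\<sigma> l, l)) (unit_entry (\<sigma> l, c)) p"
    using assms zero[of i l] \<open>\<sigma> l < d\<close>
    by (auto simp: p left_mult_def scale_entries_def unit_entry_def)
qed

text \<open>The product of the entries of \<open>A\<close> that are met on the first \<open>n\<close> steps of the orbit of \<open>l\<close>.\<close>

fun weight :: "nat \<Rightarrow> nat \<Rightarrow> 'k" where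
  "weight 0 l = 1"
| "weight (Suc n) l = weight n l * A $$ (\<sigma> ((\<sigma> ^^ n) l), (\<sigma> ^^ n) l)"

lemma weight_nonzero: "l < d \<Longrightarrow> weight n l \<noteq> 0"
  by (induction n) (simp_all add: nonzero funpow_less)

lemma funpow_left_mult_unit_entry:
  assumes "l < d" "c < d"
  shows "(left_mult d A ^^ n) (unit_entry (l, c)) = scale_entries (weight n l) (unit_entry ((\<sigma> ^^ n) l, c))"
proof (induction n)
  case (Suc n)
  then show ?case by (simp add: T_scale left_mult_unit_entry funpow_less assms)
qed simp

definition base :: "nat set \<Rightarrow> nat" where
  "base C = (SOME x. x \<in> C)"

text \<open>Going round the cycle once multiplies a basis vector by the product of all entries along it, so this is
  the characteristic polynomial of \<open>A\<close> on the span of the basis vectors that belong to the cycle.\<close>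

definition cycle_poly :: "nat set \<Rightarrow> 'k poly" where
  "cycle_poly C = monom 1 (card C) + [:- weight (card C) (base C):]"

lemma base_in: "C \<in> cycles d \<sigma> \<Longrightarrow> base C \<in> C"
  unfolding base_def some_in_eq by (rule cycle_nonempty[OF perm])

lemma base_less: "C \<in> cycles d \<sigma> \<Longrightarrow> base C < d"
  using base_in[of C] cycle_subset[OF perm, of C] by auto

lemma card_cycle_pos: "C \<in> cycles d \<sigma> \<Longrightarrow> card C > 0"
  using cycle_nonempty[OF perm] finite_cycle[OF perm] by (simp add: card_gt_0_iff)

lemma degree_cycle_poly: "C \<in> cycles d \<sigma> \<Longrightarrow> degree (cycle_poly C) = card C"
  unfolding cycle_poly_def using card_cycle_pos[of C]
  by (simp add: degree_add_eq_left degree_monom_eq)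

lemma monic_cycle_poly: "C \<in> cycles d \<sigma> \<Longrightarrow> monic (cycle_poly C)"
  using card_cycle_pos[of C]
  by (simp only: degree_cycle_poly) (cases "card C"; simp add: cycle_poly_def)

lemma act_cycle_poly:
  "act (cycle_poly C) x = (left_mult d A ^^ card C) x - scale_entries (weight (card C) (base C)) x"
  by (simp only: cycle_poly_def act_add act_monom act_pCons act_0 T_zero entries.scale_minus_left entries.scale_one
      add_0_right diff_conv_add_uminus)

lemma act_cycle_poly_base:
  assumes "C \<in> cycles d \<sigma>" "c < d"
  shows "act (cycle_poly C) (unit_entry (base C, c)) = 0"
  unfolding act_cycle_poly funpow_left_mult_unit_entry[OF base_less[OF assms(1)] assms(2)]
    funpow_card_cycle[OF perm assms(1) base_in[OF assms(1)]]
  by (rule diff_self)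

text \<open>Up to nonzero scalars, the unit matrices in column \<open>c\<close> with row in \<open>C\<close> are the images of a single one
  under the powers of \<open>A\<close>. So one generator for each cycle and column suffices, and the degrees
  \<open>|C|\<close> add up to \<open>d\<close> in each of the \<open>d\<close> columns.\<close>

theorem cyclic_decomp_cycles:
  defines "I \<equiv> cycles d \<sigma> \<times> {..<d}" and "v \<equiv> \<lambda>(C, c). unit_entry (base C, c)"
  shows "cyclic_decomp I v (\<lambda>(C, c). cycle_poly C)" "poly_span I v = square_entries d"
proof -
  have fin: "finite I" by (simp add: I_def finite_cycles[OF perm])
  show poly_span: "poly_span I v = square_entries d"
  proof
    show "poly_span I v \<subseteq> square_entries d"
      by (rule poly_span_left_mult_square) (auto simp: I_def v_def intro!: unit_entry_square base_less)
  next
    have unit: "unit_entry (l, c) \<in> poly_span I v" if lc: "l < d" "c < d" for l c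
    proof -
      obtain C where C: "C \<in> cycles d \<sigma>" "l \<in> C" using lc Union_cycles[OF perm] by blast
      obtain n where n: "l = (\<sigma> ^^ n) (base C)"
        using cycle_eq_funpow[OF perm C(1) base_in[OF C(1)]] C(2) by blast
      let ?w = "weight n (base C)"
      have "act (monom (inverse ?w) n) (v (C, c)) = unit_entry (l, c)"
        using weight_nonzero[OF base_less[OF C(1)], of n]
        unfolding v_def act_monom prod.case funpow_left_mult_unit_entry[OF base_less[OF C(1)] lc(2)]
          n[symmetric] entries.scale_scale by simp
      moreover have "act (monom (inverse ?w) n) (v (C, c)) \<in> poly_span I v"
        using C lc by (intro act_in_poly_span fin) (simp add: I_def)
      ultimately show ?thesis by simp
    qed
    show "square_entries d \<subseteq> poly_span I v"
    proof
      fix x :: "'k entries" assume "x \<in> square_entries d"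
      then have "x = (\<Sum>q\<in>{..<d} \<times> {..<d}. scale_entries (x q) (unit_entry q))"
        by (rule square_entries_expand)
      also have "\<dots> \<in> poly_span I v"
        by (rule entries.subspace_sum[OF subspace_poly_span], rule entries.subspace_scale[OF subspace_poly_span])
          (auto intro: unit)
      finally show "x \<in> poly_span I v" .
    qed
  qed
  show "cyclic_decomp I v (\<lambda>(C, c). cycle_poly C)"
  proof (rule cyclic_decomp_of_dim[OF fin])
    show "monic ((\<lambda>(C, c). cycle_poly C) s) \<and> act ((\<lambda>(C, c). cycle_poly C) s) (v s) = 0"
      if "s \<in> I" for s
      using that by (auto simp: I_def v_def monic_cycle_poly act_cycle_poly_base)
    have "(\<Sum>s\<in>I. degree ((\<lambda>(C, c). cycle_poly C) s)) = (\<Sum>(C, c)\<in>I. card C)"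
      by (intro sum.cong) (auto simp: I_def degree_cycle_poly)
    also have "\<dots> = (\<Sum>C\<in>cycles d \<sigma>. \<Sum>c<d. card C)"
      unfolding I_def by (rule sum.cartesian_product[symmetric])
    also have "\<dots> = d * d"
      using sum_card_cycles[OF perm] by (simp add: sum_distrib_left[symmetric])
    finally show "(\<Sum>s\<in>I. degree ((\<lambda>(C, c). cycle_poly C) s)) \<le> entries.dim (poly_span I v)"
      by (simp add: poly_span dim_square_entries power2_eq_square)
  qed
qed

end


section \<open>Elements of a split division algebra with a monomial matrix\<close>

text \<open>Expand the product over the sets \<open>S\<close> of factors from which the constant is taken: the degree is right
  only if the \<open>k i\<close> with \<open>i \<in> S\<close> sum to \<open>k C\<close>, that is, only for \<open>S = {C}\<close>.\<close>

lemma coeff_prod_monom_add_const: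
  fixes c :: "'a \<Rightarrow> 'b::comm_ring_1"
  assumes fin: "finite I" and C: "C \<in> I"
    and unique: "\<And>S. S \<subseteq> I \<Longrightarrow> sum k S = k C \<Longrightarrow> S = {C}"
  shows "coeff (\<Prod>i\<in>I. monom 1 (k i) + [:c i:]) (sum k I - k C) = c C"
proof -
  have const: "(\<Prod>i\<in>S. [:c i:]) = [:prod c S:]" for S
    by (induction S rule: infinite_finite_induct) (simp_all add: one_pCons)
  have mon: "(\<Prod>i\<in>S. monom 1 (k i) :: 'b poly) = monom 1 (sum k S)" for S
    by (induction S rule: infinite_finite_induct) (simp_all add: mult_monom)
  have "(\<Prod>i\<in>I. monom 1 (k i) + [:c i:]) = (\<Prod>i\<in>I. [:c i:] + monom 1 (k i))"
    by (simp add: add.commute)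
  also have "\<dots> = (\<Sum>S\<in>Pow I. monom (prod c S) (sum k (I - S)))"
    unfolding prod_add[OF fin] const mon by (simp add: smult_monom)
  finally have "coeff (\<Prod>i\<in>I. monom 1 (k i) + [:c i:]) (sum k I - k C)
      = (\<Sum>S\<in>Pow I. if sum k (I - S) = sum k I - k C then prod c S else 0)"
    by (simp add: coeff_sum)
  also have "\<dots> = (\<Sum>S\<in>Pow I. if S = {C} then c C else 0)"
  proof (intro sum.cong refl)
    fix S assume "S \<in> Pow I"
    then have S: "S \<subseteq> I" by simp
    have kC: "k C \<le> sum k I" using fin C by (rule member_le_sum[rotated 2]) simp_all
    have "sum k I = sum k S + sum k (I - S)"
      using sum.subset_diff[OF S fin, of k] by (simp add: add.commute)
    then have "sum k (I - S) = sum k I - k C \<longleftrightarrow> sum k S = k C" using kC by auto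
    also have "\<dots> \<longleftrightarrow> S = {C}" using unique[OF S] by auto
    finally show "(if sum k (I - S) = sum k I - k C then prod c S else 0) = (if S = {C} then c C else 0)"
      by simp
  qed
  also have "\<dots> = c C" using fin C by (simp add: sum.delta)
  finally show ?thesis .
qed

text \<open>The map \<open>\<phi>\<close> is an \<open>F\<close>-algebra homomorphism into \<open>M\<^sub>d(K)\<close> whose image spans \<open>M\<^sub>d(K)\<close> over \<open>K\<close>.
  These properties of a splitting representation survive conjugation.\<close>

locale split_element = division_algebra_element \<iota> d z
  for \<iota> :: "'f::field \<Rightarrow> 'd::division_ring" and d :: nat and z :: 'd +
  fixes j :: "'f \<Rightarrow> 'k::field" and \<phi> :: "'d \<Rightarrow> 'k mat"
  assumes j: "field_hom j"
    and \<phi>_carrier [simp]: "\<phi> x \<in> carrier_mat d d"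
    and \<phi>_add: "\<phi> (x + y) = \<phi> x + \<phi> y"
    and \<phi>_mult: "\<phi> (x * y) = \<phi> x * \<phi> y"
    and \<phi>_scalar: "\<phi> (\<iota> a) = j a \<cdot>\<^sub>m 1\<^sub>m d"
    and \<phi>_span: "square_entries d \<subseteq> entries.span (range (\<lambda>x. entries d (\<phi> x)))"
begin

sublocale j: field_hom j by (rule j)

sublocale M: vector_endo scale_entries "left_mult d (\<phi> z)"
  by (rule vector_endo_left_mult)

lemma \<phi>_0: "\<phi> 0 = 0\<^sub>m d d"
  using \<phi>_scalar[of 0] by (auto intro!: eq_matI)

lemma \<phi>_1: "\<phi> 1 = 1\<^sub>m d"
  using \<phi>_scalar[of 1] by (auto intro!: eq_matI)

text \<open>This is \<open>p(\<phi>(z)) X = \<phi>(p(z)) X\<close>. The left side is an action by polynomials over \<open>K\<close>, the right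
  side one by polynomials over \<open>F\<close>.\<close>

lemma act_entries:
  assumes X: "X \<in> carrier_mat d d"
  shows "M.act (map_poly j p) (entries d X) = entries d (\<phi> (act p 1) * X)"
proof (induction p)
  case 0
  have "\<phi> (act 0 1) * X = 0\<^sub>m d d" using X by (simp add: \<phi>_0)
  then show ?case by (simp only: map_poly_0 M.act_0 entries_zero)
next
  case (pCons a p)
  have Y: "\<phi> (act p 1) * X \<in> carrier_mat d d" by (rule mult_carrier_mat[OF \<phi>_carrier X])
  have "\<phi> (act (pCons a p) 1) * X = (j a \<cdot>\<^sub>m 1\<^sub>m d + \<phi> z * \<phi> (act p 1)) * X"
    by (simp add: \<phi>_add \<phi>_mult \<phi>_scalar)
  also have "\<dots> = j a \<cdot>\<^sub>m 1\<^sub>m d * X + \<phi> z * \<phi> (act p 1) * X"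
    by (rule add_mult_distrib_mat[of _ d d _ _ d]) (simp_all add: X \<phi>_mult[symmetric])
  also have "j a \<cdot>\<^sub>m 1\<^sub>m d * X = j a \<cdot>\<^sub>m X"
    using X mult_smult_assoc_mat[of "1\<^sub>m d" d d X d "j a"] by simp
  also have "\<phi> z * \<phi> (act p 1) * X = \<phi> z * (\<phi> (act p 1) * X)"
    by (rule assoc_mult_mat[of _ d d _ d]) (use X in auto)
  finally have "entries d (\<phi> (act (pCons a p) 1) * X)
      = scale_entries (j a) (entries d X) + left_mult d (\<phi> z) (entries d (\<phi> (act p 1) * X))"
    using entries_add[OF smult_carrier_mat[OF X] mult_carrier_mat[OF \<phi>_carrier Y]]
      entries_smult[OF X] entries_mult[OF \<phi>_carrier Y] by simp
  then show ?case by (simp add: j.map_poly_pCons_hom pCons.IH)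
qed

lemma act_entries_\<phi>: "M.act (map_poly j p) (entries d (\<phi> y)) = entries d (\<phi> (act p y))"
  using act_entries[OF \<phi>_carrier, of p y] act_eq_act_1_mult[of p y] by (simp add: \<phi>_mult)

lemma entries_\<phi>_sum: "entries d (\<phi> (\<Sum>b\<in>B. y b)) = (\<Sum>b\<in>B. entries d (\<phi> (y b)))"
proof -
  have zero: "entries d (\<phi> 0) = 0"
    by (simp only: \<phi>_0 entries_zero)
  show ?thesis
    by (induction B rule: infinite_finite_induct)
      (simp_all only: sum.infinite sum.empty sum.insert zero \<phi>_add entries_add[OF \<phi>_carrier \<phi>_carrier] not_False_eq_True)
qed

text \<open>A basis of \<open>D\<close> over \<open>F(z)\<close> generates \<open>M\<^sub>d(K)\<close> because \<open>D\<close> spans it, and the dimension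
  \<open>|B| degree f = d\<^sup>2\<close> is the right one. The bijection \<open>\<pi>\<close> allows for another indexing of the basis.\<close>

lemma cyclic_decomp_transfer:
  assumes f: "monic f" "act f 1 = 0"
    and B: "finite B" "poly_span B (\<lambda>b. b) = UNIV" "card B * degree f = d\<^sup>2"
    and \<pi>: "bij_betw \<pi> J B"
  defines "v \<equiv> \<lambda>i. entries d (\<phi> (\<pi> i))"
  shows "M.cyclic_decomp J v (\<lambda>_. map_poly j f)" "M.poly_span J v = square_entries d"
proof -
  have fin: "finite J" using B(1) \<pi> by (simp add: bij_betw_finite)
  have card: "card J = card B" using \<pi> by (rule bij_betw_same_card)
  show poly_span: "M.poly_span J v = square_entries d"
  proof
    show "M.poly_span J v \<subseteq> square_entries d"
      by (rule poly_span_left_mult_square) (simp add: v_def square_entries_def)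
    have "entries d (\<phi> x) \<in> M.poly_span J v" for x
    proof -
      have "x \<in> poly_span B (\<lambda>b. b)" using B(2) by simp
      then obtain r where x: "x = (\<Sum>b\<in>B. act (r b) b)" unfolding poly_span_def by auto
      have "entries d (\<phi> x) = (\<Sum>b\<in>B. M.act (map_poly j (r b)) (entries d (\<phi> b)))"
        by (simp only: x entries_\<phi>_sum act_entries_\<phi>)
      also have "\<dots> = (\<Sum>i\<in>J. M.act (map_poly j (r (\<pi> i))) (v i))"
        unfolding v_def by (rule sum.reindex_bij_betw[OF \<pi>, symmetric])
      finally show ?thesis by (rule M.poly_spanI)
    qed
    then have "entries.span (range (\<lambda>x. entries d (\<phi> x))) \<subseteq> M.poly_span J v"
      by (intro entries.span_minimal M.subspace_poly_span) auto
    then show "square_entries d \<subseteq> M.poly_span J v" using \<phi>_span by blast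
  qed
  show "M.cyclic_decomp J v (\<lambda>_. map_poly j f)"
  proof (rule M.cyclic_decomp_of_dim[OF fin])
    show "(\<Sum>s\<in>J. degree (map_poly j f)) \<le> entries.dim (M.poly_span J v)"
      using B(3) by (simp add: card poly_span dim_square_entries)
    fix s
    have "act f (\<pi> s) = 0" using act_eq_act_1_mult[of f "\<pi> s"] f(2) by simp
    then have "M.act (map_poly j f) (v s) = 0"
      by (simp only: v_def act_entries_\<phi> \<phi>_0 entries_zero)
    then show "monic (map_poly j f) \<and> M.act (map_poly j f) (v s) = 0" using f(1) by simp
  qed
qed

context
  fixes \<sigma> :: "nat \<Rightarrow> nat"
  assumes monomial: "monomial_matrix d (\<phi> z) \<sigma>"
begin

interpretation A: monomial_matrix d "\<phi> z" \<sigma> by (rule monomial)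

text \<open>Compare the two decompositions of \<open>M\<^sub>d(K)\<close>. Let \<open>p\<close> be a prime factor of \<open>f\<close> over \<open>K\<close> and \<open>m\<close> the number
  of cycle polynomials that it divides. It divides the annihilators of \<open>m d\<close> summands of the first
  decomposition, which has one for each cycle and column, and of all \<open>|B| = d\<^sup>2/degree f\<close> summands of the
  second. Hence \<open>m degree f = d\<close>, and the second decomposition also consists of \<open>d\<close> copies of the
  same sequence of \<open>m\<close> summands, so that the products over one copy agree.\<close>

theorem prod_cycle_poly:
  obtains f m where "monic f" "act f 1 = 0" "\<And>q. act q 1 = 0 \<Longrightarrow> f dvd q"
    "m * degree f = d" "(\<Prod>C\<in>cycles d \<sigma>. A.cycle_poly C) = map_poly j (f ^ m)"
proof -
  obtain f B where f: "monic f" "act f 1 = 0" "\<And>q. act q 1 = 0 \<Longrightarrow> f dvd q"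
    and B: "cyclic_decomp B (\<lambda>b. b) (\<lambda>_. f)" "poly_span B (\<lambda>b. b) = UNIV" "card B * degree f = d\<^sup>2"
    by (rule free_over_generated_subfield) blast
  have fin: "finite B" using B(1) by (simp add: cyclic_decomp_def)
  let ?f = "map_poly j f" and ?I = "cycles d \<sigma>"
  note transfer = cyclic_decomp_transfer[OF f(1,2) fin B(2,3)]
  have "degree f > 0"
    using f(1,2) monic_degree_0[of f] by (cases "degree f = 0") auto
  then have "degree ?f > 0" by simp
  from irreducible_monic_factor[OF this] obtain p q
    where p: "irreducible p" "?f = p * q" "monic p" by blast
  have prime: "prime_elem p" by (rule field_poly_irreducible_imp_prime[OF p(1)])
  define m where "m = card {C \<in> ?I. p dvd A.cycle_poly C}"
  have "card {s \<in> ?I \<times> {..<d}. p dvd (\<lambda>(C, c). A.cycle_poly C) s} = card {s \<in> B. p dvd ?f}"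
    by (rule M.cyclic_decomp_card_dvd_unique[OF A.cyclic_decomp_cycles(1) transfer(1)[OF bij_betw_id]
        _ prime p(3)])
      (simp only: A.cyclic_decomp_cycles(2) transfer(2)[OF bij_betw_id])
  moreover have "{s \<in> ?I \<times> {..<d}. p dvd (\<lambda>(C, c). A.cycle_poly C) s}
      = {C \<in> ?I. p dvd A.cycle_poly C} \<times> {..<d}" by auto
  moreover have "{s \<in> B. p dvd ?f} = B" using p(2) by auto
  ultimately have cardB: "card B = m * d" by (simp only: m_def card_cartesian_product card_lessThan)
  have "m * degree f = d"
  proof -
    have "(m * degree f) * d = d * d" using B(3) cardB by (simp add: power2_eq_square ac_simps)
    then show ?thesis using d_pos by (metis mult_cancel2 less_not_refl)
  qed
  moreover have "(\<Prod>C\<in>?I. A.cycle_poly C) = map_poly j (f ^ m)"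
  proof -
    obtain \<pi> where \<pi>: "bij_betw \<pi> ({..<m} \<times> {..<d}) B"
      using finite_same_card_bij[of "{..<m} \<times> {..<d}" B] fin cardB by auto
    have "(\<Prod>C\<in>?I. A.cycle_poly C) = (\<Prod>i<m. ?f)"
    proof (rule M.cyclic_decomp_prod_unique[OF d_pos finite_cycles[OF A.perm] finite_lessThan
          A.cyclic_decomp_cycles(1)])
      show "M.cyclic_decomp ({..<m} \<times> {..<d}) (\<lambda>i. entries d (\<phi> (\<pi> i))) (\<lambda>(s, c). ?f)"
        using transfer(1)[OF \<pi>] by (simp add: case_prod_beta')
      show "M.poly_span (?I \<times> {..<d}) (\<lambda>(C, c). unit_entry (A.base C, c))
          = M.poly_span ({..<m} \<times> {..<d}) (\<lambda>i. entries d (\<phi> (\<pi> i)))"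
        by (simp only: A.cyclic_decomp_cycles(2) transfer(2)[OF \<pi>])
    qed
    also have "\<dots> = ?f ^ m" by simp
    also have "\<dots> = map_poly j (f ^ m)"
    proof -
      interpret map_poly_inj_idom_hom j ..
      show ?thesis by (simp add: hom_power)
    qed
    finally show ?thesis .
  qed
  ultimately show ?thesis using f that by blast
qed

text \<open>The first condition for a lonely cycle gives \<open>z\<^sup>k = \<alpha>\<close> with \<open>\<alpha>\<close> in \<open>F\<close>, where \<open>k\<close> is the length of the
  cycle. Then \<open>k\<close> is maximal and equal to the degree of \<open>f\<close>, which divides \<open>d\<close>, contrary to the second
  condition.\<close>

theorem not_lonely:
  assumes C: "C \<in> cycles d \<sigma>" shows "\<not> lonely d \<sigma> C"
proof
  assume lonely: "lonely d \<sigma> C"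
  let ?k = "card C" and ?I = "cycles d \<sigma>"
  obtain f m where f: "monic f" "act f 1 = 0" "\<And>q. act q 1 = 0 \<Longrightarrow> f dvd q"
    and m: "m * degree f = d" and prod: "(\<Prod>C\<in>?I. A.cycle_poly C) = map_poly j (f ^ m)"
    by (rule prod_cycle_poly) blast
  define w where "w = A.weight ?k (A.base C)"
  have fin: "finite ?I" by (rule finite_cycles[OF A.perm])
  have kpos: "?k > 0" by (rule A.card_cycle_pos[OF C])
  \<comment> \<open>The indicator function of \<open>S\<close> is a choice of the \<open>\<epsilon>\<close> in the first condition.\<close>
  have unique: "S = {C}" if S: "S \<subseteq> ?I" and sum: "sum card S = ?k" for S
  proof -
    define \<epsilon> :: "nat set \<Rightarrow> nat" where "\<epsilon> B = (if B \<in> S then 1 else 0)" for B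
    have "(\<Sum>B\<in>?I. \<epsilon> B * card B) = (\<Sum>B\<in>?I. if B \<in> S then card B else 0)"
      by (intro sum.cong) (simp_all add: \<epsilon>_def)
    also have "\<dots> = sum card (?I \<inter> S)" using fin by (simp add: sum.inter_restrict)
    also have "?I \<inter> S = S" using S by blast
    finally have "?k = (\<Sum>B\<in>?I. \<epsilon> B * card B)" by (simp add: sum)
    moreover have "\<epsilon> ` ?I \<subseteq> {0, 1}" by (auto simp: \<epsilon>_def)
    ultimately have "\<forall>B\<in>?I. B \<noteq> C \<longrightarrow> \<epsilon> B = 0"
      using lonely unfolding lonely_def by blast
    then have "S \<subseteq> {C}" using S by (auto simp: \<epsilon>_def split: if_splits)
    moreover have "S \<noteq> {}" using sum kpos by auto
    ultimately show ?thesis by blast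
  qed
  \<comment> \<open>The coefficient of \<open>x\<^bsup>d-k\<^esup>\<close>, as the cycle lengths sum to \<open>d\<close>.\<close>
  have "- w = coeff (\<Prod>B\<in>?I. A.cycle_poly B) (sum card ?I - ?k)"
    unfolding A.cycle_poly_def w_def
    by (rule coeff_prod_monom_add_const[OF fin C unique, symmetric])
  also have "\<dots> = j (coeff (f ^ m) (sum card ?I - ?k))" by (simp add: prod)
  finally have w: "w = j (- coeff (f ^ m) (sum card ?I - ?k))"
    by (simp add: j.hom_uminus) (metis minus_minus)
  then obtain \<alpha> where \<alpha>: "w = j \<alpha>" by blast
  define q where "q = monom 1 ?k + [:- \<alpha>:]"
  have mq: "map_poly j q = A.cycle_poly C"
    unfolding q_def A.cycle_poly_def w_def[symmetric] \<alpha>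
    by (simp add: j.map_poly_hom_add j.map_poly_pCons_hom j.hom_uminus)
  let ?e = "unit_entry (A.base C, 0) :: 'k entries"
  have e_square: "?e \<in> square_entries d" using A.base_less[OF C] d_pos by (rule unit_entry_square)
  then obtain E where E: "E \<in> carrier_mat d d" "?e = entries d E"
    unfolding square_entries_def by blast
  have e0: "?e \<noteq> 0" by (auto simp: unit_entry_def fun_eq_iff)
  \<comment> \<open>The matrix of \<open>z\<^sup>k - \<alpha>\<close> kills the nonzero vector \<open>?e\<close>, so \<open>z\<^sup>k - \<alpha>\<close> has no inverse.\<close>
  have q0: "act q 1 = 0"
  proof (rule ccontr)
    let ?u = "act q 1"
    assume u: "?u \<noteq> 0"
    have "entries d (\<phi> ?u * E) = 0"
      using act_entries[OF E(1), of q] A.act_cycle_poly_base[OF C d_pos] by (simp add: mq E(2))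
    then have zero: "\<phi> ?u * E = 0\<^sub>m d d"
      using entries_eq_zero_iff[of "\<phi> ?u * E" d] E(1) \<phi>_carrier[of ?u] by simp
    have "E = \<phi> (inverse ?u * ?u) * E" using u E(1) by (simp add: \<phi>_1)
    also have "\<dots> = \<phi> (inverse ?u) * (\<phi> ?u * E)"
      unfolding \<phi>_mult by (rule assoc_mult_mat[of _ d d _ d]) (use E in auto)
    also have "\<dots> = 0\<^sub>m d d"
      unfolding zero by (rule right_mult_zero_mat[OF \<phi>_carrier])
    finally show False using e0 E entries_eq_zero_iff[of E d] by simp
  qed
  \<comment> \<open>As \<open>A\<^sup>k\<close> is scalar, \<open>\<sigma>\<^sup>k\<close> fixes every index.\<close>
  have max: "card B \<le> ?k" if B: "B \<in> ?I" for B
  proof (rule card_cycle_le[OF A.perm B A.base_in[OF B] _ kpos], rule ccontr)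
    let ?b = "A.base B"
    assume neq: "(\<sigma> ^^ ?k) ?b \<noteq> ?b"
    have "(unit_entry (?b, 0) :: 'k entries) \<in> square_entries d"
      using A.base_less[OF B] d_pos by (rule unit_entry_square)
    then obtain X where X: "X \<in> carrier_mat d d" "(unit_entry (?b, 0) :: 'k entries) = entries d X"
      unfolding square_entries_def by blast
    have "entries d (\<phi> 0 * X) = 0" using X(1) by (simp add: \<phi>_0 entries_zero)
    then have "M.act (A.cycle_poly C) (unit_entry (?b, 0)) = 0"
      using act_entries[OF X(1), of q] by (simp add: mq X(2) q0)
    then have "scale_entries (A.weight ?k ?b) (unit_entry ((\<sigma> ^^ ?k) ?b, 0))
        = scale_entries w (unit_entry (?b, 0))"
      unfolding A.act_cycle_poly A.funpow_left_mult_unit_entry[OF A.base_less[OF B] d_pos] w_def by simp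
    from fun_cong[OF this, of "((\<sigma> ^^ ?k) ?b, 0)"] have "A.weight ?k ?b = 0"
      using neq by (simp add: scale_entries_def unit_entry_def)
    then show False using A.weight_nonzero[OF A.base_less[OF B]] by simp
  qed
  have "f \<noteq> 0" using f(1) by auto
  have "degree f \<le> ?k"
  proof -
    have "degree q = ?k" using j.degree_map_poly_hom[of q] A.degree_cycle_poly[OF C] by (simp add: mq)
    moreover from this have "q \<noteq> 0" using kpos by auto
    ultimately show ?thesis using dvd_imp_degree_le[OF f(3)[OF q0]] by simp
  qed
  moreover have "?k \<le> degree f"
  proof -
    have "M.act (map_poly j f) ?e = entries d (\<phi> 0 * E)"
      using act_entries[OF E(1), of f] by (simp add: E(2) f(2))
    also have "\<dots> = 0" using E(1) by (simp add: \<phi>_0 entries_zero)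
    finally have "A.cycle_poly C dvd map_poly j f"
      using M.cyclic_decomp_annihilator_dvd[OF A.cyclic_decomp_cycles(1), of "(C, 0)"] C d_pos by simp
    then show ?thesis
      using dvd_imp_degree_le[of "A.cycle_poly C" "map_poly j f"] \<open>f \<noteq> 0\<close>
      by (simp add: A.degree_cycle_poly[OF C])
  qed
  ultimately have "?k dvd d" using m by (metis dvd_triv_right le_antisym)
  moreover have "(\<forall>B\<in>?I. card B \<le> ?k) \<longrightarrow> \<not> ?k dvd d"
    using lonely unfolding lonely_def by (rule conjunct2)
  ultimately show False using max by simp
qed

end
end


section \<open>The matrices and the permutation of a coset\<close>

lemma carrier_GL: "carrier (GL d) \<subseteq> carrier_mat d d"
  by (auto simp: GL_def units_of_def Units_def ring_mat_simps)

lemma mult_GL: "monoid.mult (GL d) = (*)" and one_GL: "one (GL d) = 1\<^sub>m d"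
  by (simp_all add: GL_def units_of_def ring_mat_simps)

lemma group_GL: "group (GL d :: 'k::field mat monoid)"
proof -
  interpret ring "ring_mat TYPE('k) d ()" by (rule ring_mat)
  show ?thesis unfolding GL_def by (rule units_group)
qed

lemma inv_GL:
  assumes "g \<in> carrier (GL d)"
  shows "inv\<^bsub>GL d\<^esub> g \<in> carrier_mat d d" "g * inv\<^bsub>GL d\<^esub> g = 1\<^sub>m d" "inv\<^bsub>GL d\<^esub> g * g = 1\<^sub>m d"
  using group.inv_closed[OF group_GL assms] carrier_GL
    group.r_inv[OF group_GL assms] group.l_inv[OF group_GL assms]
  by (auto simp: mult_GL one_GL)

lemma diagonal_group_entry_nonzero:
  fixes t :: "'k::field mat"
  assumes t: "t \<in> diagonal_group d" and i: "i < d"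
  shows "t $$ (i, i) \<noteq> 0"
proof
  assume zero: "t $$ (i, i) = 0"
  have tG: "t \<in> carrier (GL d)" and diag: "diagonal_mat t" using t by (auto simp: diagonal_group_def)
  have tc: "t \<in> carrier_mat d d" using tG carrier_GL by blast
  let ?s = "inv\<^bsub>GL d\<^esub> t"
  have "t $$ (i, l) = 0" if "l < d" for l
    using zero diag tc i that by (cases "l = i") (auto simp: diagonal_mat_def)
  then have "(t * ?s) $$ (i, i) = 0"
    using inv_GL(1)[OF tG] tc i by (simp add: scalar_prod_def)
  then show False using inv_GL(2)[OF tG] i by simp
qed

lemma diagonal_mult_entry:
  fixes t :: "'k::field mat"
  assumes t: "t \<in> diagonal_group d" and a: "a \<in> carrier_mat d d" and "i < d" "l < d"
  shows "(t * a) $$ (i, l) = t $$ (i, i) * a $$ (i, l)"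
proof -
  have diag: "diagonal_mat t" using t by (auto simp: diagonal_group_def)
  have tc: "t \<in> carrier_mat d d" using t carrier_GL by (auto simp: diagonal_group_def)
  have "(t * a) $$ (i, l) = (\<Sum>m<d. t $$ (i, m) * a $$ (m, l))"
    using assms tc by (simp add: scalar_prod_def lessThan_atLeast0)
  also have "\<dots> = (\<Sum>m<d. if m = i then t $$ (i, i) * a $$ (i, l) else 0)"
    using diag tc assms by (intro sum.cong) (auto simp: diagonal_mat_def)
  finally show ?thesis using assms by (simp add: sum.delta)
qed

lemma monomial_perm_cong:
  assumes "A \<in> carrier_mat d d" "B \<in> carrier_mat d d"
    and "\<And>i l. i < d \<Longrightarrow> l < d \<Longrightarrow> A $$ (i, l) \<noteq> 0 \<longleftrightarrow> B $$ (i, l) \<noteq> 0"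
  shows "monomial_perm A = monomial_perm B"
proof
  fix l
  have "(i < dim_row A \<and> A $$ (i, l) \<noteq> 0) = (i < dim_row B \<and> B $$ (i, l) \<noteq> 0)" if "l < d" for i
    using assms that by auto
  then show "monomial_perm A l = monomial_perm B l"
    using assms(1,2) by (auto simp: monomial_perm_def)
qed

text \<open>Members of a coset differ by the multiplication of rows by nonzero factors, so their nonzero entries
  are in the same places.\<close>

lemma coset_perm_eq:
  fixes X :: "'k::field mat set"
  assumes X: "X \<in> carrier (weyl_group d)" and A: "A \<in> X"
  shows "A \<in> carrier_mat d d" "monomial_mat A" "coset_perm X = monomial_perm A"
proof -
  let ?N = "(GL d)\<lparr>carrier := monomial_group d\<rparr> :: 'k mat monoid"
  obtain a where a: "a \<in> monomial_group d" "X = diagonal_group d #>\<^bsub>?N\<^esub> a"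
    using X unfolding weyl_group_def FactGroup_def RCOSETS_def by auto
  have ac: "a \<in> carrier_mat d d" and amon: "monomial_mat a"
    using a(1) carrier_GL by (auto simp: monomial_group_def)
  have X_eq: "X = {t * a | t. t \<in> diagonal_group d}"
    unfolding a(2) r_coset_def by (auto simp: mult_GL)
  have pattern: "n \<in> carrier_mat d d \<and> (\<forall>i<d. \<forall>l<d. n $$ (i, l) \<noteq> 0 \<longleftrightarrow> a $$ (i, l) \<noteq> 0)"
    if n: "n \<in> X" for n
  proof -
    obtain t where t: "t \<in> diagonal_group d" "n = t * a" using n X_eq by blast
    have "t \<in> carrier_mat d d" using t carrier_GL by (auto simp: diagonal_group_def)
    then have "n \<in> carrier_mat d d" using ac t(2) by simp
    then show ?thesis
      using t diagonal_mult_entry[OF t(1) ac] diagonal_group_entry_nonzero[OF t(1)] by auto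
  qed
  show Ac: "A \<in> carrier_mat d d" using pattern[OF A] by blast
  show "monomial_mat A"
    using amon pattern[OF A] ac Ac unfolding monomial_mat_def by (auto cong: conj_cong)
  have perm: "monomial_perm n = monomial_perm a" if "n \<in> X" for n
    using pattern[OF that] ac by (intro monomial_perm_cong[of _ d]) auto
  then show "coset_perm X = monomial_perm A"
    unfolding coset_perm_def using A by (intro the_equality) auto
qed

lemma monomial_matrix_monomial_perm:
  fixes A :: "'k::field mat"
  assumes A: "A \<in> carrier_mat d d" and mon: "monomial_mat A"
  shows "monomial_matrix d A (monomial_perm A)"
proof -
  let ?\<sigma> = "monomial_perm A"
  have col: "\<exists>!i. i < d \<and> A $$ (i, l) \<noteq> 0" and row: "\<exists>!m. m < d \<and> A $$ (l, m) \<noteq> 0" if "l < d" for l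
    using mon A that by (auto simp: monomial_mat_def)
  have \<sigma>: "?\<sigma> l < d \<and> A $$ (?\<sigma> l, l) \<noteq> 0" if "l < d" for l
    using theI'[OF col[OF that]] that A by (simp add: monomial_perm_def)
  have inj: "inj_on ?\<sigma> {..<d}"
  proof (rule inj_onI)
    fix x y assume "x \<in> {..<d}" "y \<in> {..<d}" "?\<sigma> x = ?\<sigma> y"
    then show "x = y" using \<sigma>[of x] \<sigma>[of y] row[of "?\<sigma> x"] by auto
  qed
  have "?\<sigma> permutes {..<d}"
  proof (rule bij_imp_permutes)
    show "bij_betw ?\<sigma> {..<d} {..<d}"
      unfolding bij_betw_def using inj \<sigma>
      by (intro conjI endo_inj_surj) auto
    show "?\<sigma> x = x" if "x \<notin> {..<d}" for x using that A by (simp add: monomial_perm_def)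
  qed
  moreover have "A $$ (i, l) = 0" if "i < d" "l < d" "i \<noteq> ?\<sigma> l" for i l
    using col[OF that(2)] \<sigma>[OF that(2)] that by blast
  ultimately show ?thesis using A \<sigma> by unfold_locales auto
qed


section \<open>Splitting representations up to conjugation\<close>

text \<open>Composing the given isomorphism with the quotient map yields a homomorphism on the ring of formal
  integer combinations of generators, where cosets no longer appear.\<close>

lemma splitting_representation_hom:
  fixes \<iota> :: "'f::field \<Rightarrow> 'd::division_ring" and j :: "'f \<Rightarrow> 'k::field"
  assumes "splitting_representation \<iota> j d \<phi>"
  obtains \<Psi> :: "(('d, 'k) tensor_gen \<Rightarrow>\<^sub>0 int) \<Rightarrow> 'k mat" where
    "range \<Psi> = carrier_mat d d" "\<And>P Q. \<Psi> (P + Q) = \<Psi> P + \<Psi> Q" "\<And>P Q. \<Psi> (P * Q) = \<Psi> P * \<Psi> Q"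
    "\<And>P. P \<in> tensor_relations \<iota> j \<Longrightarrow> \<Psi> P = 0\<^sub>m d d"
    "\<And>c. \<Psi> (gen 1 c) = c \<cdot>\<^sub>m 1\<^sub>m d" "\<And>x. \<Psi> (gen x 1) = \<phi> x"
proof -
  let ?R = "gen_ring :: (('d, 'k) tensor_gen \<Rightarrow>\<^sub>0 int) ring" and ?M = "ring_mat TYPE('k) d ()"
  let ?I = "tensor_ideal \<iota> j :: (('d, 'k) tensor_gen \<Rightarrow>\<^sub>0 int) set"
  interpret I: ideal ?I ?R by (rule ideal_tensor_ideal)
  interpret R: ring ?R by (rule ring_gen_ring)
  interpret M: ring ?M by (rule ring_mat)
  have carr: "carrier ?R = UNIV" by (simp add: gen_ring_def)
  obtain \<psi> where \<psi>: "\<psi> \<in> ring_iso (tensor_algebra \<iota> j) ?M"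
    and \<psi>1: "\<And>c. \<psi> (pure_tensor \<iota> j 1 c) = c \<cdot>\<^sub>m 1\<^sub>m d"
    and \<psi>2: "\<And>x. \<phi> x = \<psi> (pure_tensor \<iota> j x 1)"
    using assms unfolding splitting_representation_def by blast
  define \<Psi> where "\<Psi> = \<psi> \<circ> (+>\<^bsub>?R\<^esub>) ?I"
  have hom: "\<Psi> \<in> ring_hom ?R ?M"
    unfolding \<Psi>_def
    by (rule ring_hom_trans[OF I.rcos_ring_hom])
      (use \<psi> in \<open>simp add: ring_iso_def tensor_algebra_def\<close>)
  have bij: "bij_betw \<psi> (carrier (tensor_algebra \<iota> j)) (carrier_mat d d)"
    using \<psi> by (simp add: ring_iso_def ring_mat_simps)
  have "carrier (tensor_algebra \<iota> j) = range ((+>\<^bsub>?R\<^esub>) ?I)"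
    by (auto simp: tensor_algebra_def FactRing_def A_RCOSETS_def' carr)
  then have "range \<Psi> = carrier_mat d d"
    using bij unfolding \<Psi>_def bij_betw_def by (simp only: image_comp)
  moreover have add: "\<Psi> (P + Q) = \<Psi> P + \<Psi> Q" for P Q
    using ring_hom_add[OF hom, of P Q] by (simp add: gen_ring_def ring_mat_simps)
  moreover have "\<Psi> (P * Q) = \<Psi> P * \<Psi> Q" for P Q
    using ring_hom_mult[OF hom, of P Q] by (simp add: gen_ring_def ring_mat_simps)
  moreover have "\<Psi> P = 0\<^sub>m d d" if "P \<in> tensor_relations \<iota> j" for P
  proof -
    have "P \<in> ?I" using ring.genideal_self[OF ring_gen_ring, of "tensor_relations \<iota> j"] that
      by (auto simp: tensor_ideal_def carr)
    then have "?I +>\<^bsub>?R\<^esub> P = ?I +>\<^bsub>?R\<^esub> \<zero>\<^bsub>?R\<^esub>"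
      using I.a_rcos_const[of P] I.a_rcos_const[of "\<zero>\<^bsub>?R\<^esub>"] by simp
    then have "\<Psi> P = \<Psi> \<zero>\<^bsub>?R\<^esub>" by (simp add: \<Psi>_def)
    also have "\<dots> = 0\<^sub>m d d"
      using ring_hom_zero[OF hom ring_gen_ring ring_mat] by (simp add: ring_mat_simps)
    finally show ?thesis .
  qed
  moreover have "\<Psi> (gen 1 c) = c \<cdot>\<^sub>m 1\<^sub>m d" for c
    using \<psi>1[of c] by (simp add: \<Psi>_def pure_tensor_def)
  moreover have "\<Psi> (gen x 1) = \<phi> x" for x
    using \<psi>2[of x] by (simp add: \<Psi>_def pure_tensor_def)
  ultimately show ?thesis by (rule that)
qed

text \<open>The defining relations of the tensor product make \<open>\<phi>\<close> additive and fix it on \<open>F\<close>. Its image spans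
  because every matrix comes from an integer combination of generators \<open>x \<otimes> c\<close>, and these are mapped
  to the multiples \<open>c \<phi>(x)\<close>. All of this is preserved by conjugation.\<close>

lemma splitting_representation_facts:
  fixes \<iota> :: "'f::field \<Rightarrow> 'd::division_ring" and j :: "'f \<Rightarrow> 'k::field"
  assumes split: "splitting_representation \<iota> j d \<phi>"
    and g: "g \<in> carrier_mat d d" and h: "h \<in> carrier_mat d d"
    and gh: "g * h = 1\<^sub>m d" and hg: "h * g = 1\<^sub>m d"
  defines "\<phi>' \<equiv> \<lambda>x. g * \<phi> x * h"
  shows "\<phi>' x \<in> carrier_mat d d" "\<phi>' (x + y) = \<phi>' x + \<phi>' y" "\<phi>' (x * y) = \<phi>' x * \<phi>' y"
    "\<phi>' (\<iota> a) = j a \<cdot>\<^sub>m 1\<^sub>m d"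
    "square_entries d \<subseteq> entries.span (range (\<lambda>x. entries d (\<phi>' x)))"
proof -
  obtain \<Psi> :: "(('d, 'k) tensor_gen \<Rightarrow>\<^sub>0 int) \<Rightarrow> 'k mat" where
    range: "range \<Psi> = carrier_mat d d" and add: "\<And>P Q. \<Psi> (P + Q) = \<Psi> P + \<Psi> Q"
    and mult: "\<And>P Q. \<Psi> (P * Q) = \<Psi> P * \<Psi> Q"
    and rel: "\<And>P. P \<in> tensor_relations \<iota> j \<Longrightarrow> \<Psi> P = 0\<^sub>m d d"
    and \<Psi>1: "\<And>c. \<Psi> (gen 1 c) = c \<cdot>\<^sub>m 1\<^sub>m d" and \<Psi>2: "\<And>x. \<Psi> (gen x 1) = \<phi> x"
    using splitting_representation_hom[OF split] by blast
  have carr [simp]: "\<Psi> P \<in> carrier_mat d d" for P using range by blast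
  have carr\<phi> [simp]: "\<phi> x \<in> carrier_mat d d" for x using carr[of "gen x 1"] by (simp add: \<Psi>2)
  note [simp] = g h
  have \<phi>_add: "\<phi> (x + y) = \<phi> x + \<phi> y" for x y
  proof -
    let ?r = "gen (x + y) 1 - gen x 1 - gen y 1 :: ('d, 'k) tensor_gen \<Rightarrow>\<^sub>0 int"
    have "?r \<in> tensor_relations \<iota> j" unfolding tensor_relations_def by blast
    then have "\<Psi> ?r = 0\<^sub>m d d" by (rule rel)
    moreover have "\<Psi> (gen (x + y) 1) = \<Psi> ?r + (\<Psi> (gen x 1) + \<Psi> (gen y 1))"
      by (simp only: add[symmetric]) simp
    ultimately show ?thesis by (simp add: \<Psi>2)
  qed
  have \<phi>_mult: "\<phi> (x * y) = \<phi> x * \<phi> y" for x y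
    by (simp only: \<Psi>2[symmetric] mult[symmetric]) (simp add: mult_single)
  have \<phi>_scalar: "\<phi> (\<iota> a) = j a \<cdot>\<^sub>m 1\<^sub>m d" for a
  proof -
    let ?r = "gen (1 * \<iota> a) 1 - gen 1 (j a * 1) :: ('d, 'k) tensor_gen \<Rightarrow>\<^sub>0 int"
    have "?r \<in> tensor_relations \<iota> j" unfolding tensor_relations_def by blast
    then have "\<Psi> ?r = 0\<^sub>m d d" by (rule rel)
    moreover have "\<Psi> (gen (\<iota> a) 1) = \<Psi> ?r + \<Psi> (gen 1 (j a))"
      by (simp only: add[symmetric]) simp
    ultimately show ?thesis by (simp add: \<Psi>1 \<Psi>2)
  qed
  show carr': "\<phi>' x \<in> carrier_mat d d" for x
    unfolding \<phi>'_def by (intro mult_carrier_mat[of _ d d]) simp_all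
  have conj_add: "g * (P + Q) * h = g * P * h + g * Q * h"
    if "P \<in> carrier_mat d d" "Q \<in> carrier_mat d d" for P Q
    using that mult_add_distrib_mat[OF g that]
      add_mult_distrib_mat[OF mult_carrier_mat[OF g that(1)] mult_carrier_mat[OF g that(2)] h] by simp
  show "\<phi>' (x + y) = \<phi>' x + \<phi>' y" by (simp add: \<phi>'_def \<phi>_add conj_add)
  show "\<phi>' (x * y) = \<phi>' x * \<phi>' y"
  proof -
    have gx: "g * \<phi> x \<in> carrier_mat d d" by (rule mult_carrier_mat[OF g]) simp
    have yh: "\<phi> y * h \<in> carrier_mat d d" by (rule mult_carrier_mat[OF _ h]) simp
    have "\<phi>' x * \<phi>' y = g * \<phi> x * h * (g * (\<phi> y * h))"
      unfolding \<phi>'_def by (simp add: assoc_mult_mat[of g d d "\<phi> y" d h d])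
    also have "\<dots> = g * \<phi> x * (h * (g * (\<phi> y * h)))"
      by (rule assoc_mult_mat[OF gx h]) (rule mult_carrier_mat[OF g yh])
    also have "h * (g * (\<phi> y * h)) = \<phi> y * h"
      using assoc_mult_mat[OF h g yh] left_mult_one_mat[OF yh] by (simp add: hg)
    also have "g * \<phi> x * (\<phi> y * h) = g * (\<phi> x * \<phi> y) * h"
      using assoc_mult_mat[OF gx carr\<phi>[of y] h] assoc_mult_mat[OF g carr\<phi>[of x] carr\<phi>[of y]] by simp
    finally show ?thesis by (simp add: \<phi>'_def \<phi>_mult)
  qed
  have conj_smult: "g * (c \<cdot>\<^sub>m P) * h = c \<cdot>\<^sub>m (g * P * h)" if P: "P \<in> carrier_mat d d" for c P
    using mult_smult_distrib[OF g P, of c] mult_smult_assoc_mat[OF mult_carrier_mat[OF g P] h, of c] by simp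
  show "\<phi>' (\<iota> a) = j a \<cdot>\<^sub>m 1\<^sub>m d"
    unfolding \<phi>'_def \<phi>_scalar by (simp add: conj_smult right_mult_one_mat[OF g] gh)

  let ?S = "entries.span (range (\<lambda>x. entries d (\<phi>' x)))"
  define H where "H P = entries d (g * \<Psi> P * h)" for P
  have carr_conj: "g * \<Psi> P * h \<in> carrier_mat d d" for P
    by (intro mult_carrier_mat[of _ d d]) simp_all
  interpret H: additive H
    by unfold_locales (simp add: H_def add conj_add entries_add[OF carr_conj carr_conj])
  have H_gen: "H (gen x c) \<in> ?S" for x c
  proof -
    have "gen x c = gen x 1 * (gen 1 c :: ('d, 'k) tensor_gen \<Rightarrow>\<^sub>0 int)" by (simp add: mult_single)
    then have "\<Psi> (gen x c) = \<phi> x * (c \<cdot>\<^sub>m 1\<^sub>m d)" by (simp only: mult \<Psi>1 \<Psi>2)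
    also have "\<dots> = c \<cdot>\<^sub>m \<phi> x"
      using mult_smult_distrib[OF carr\<phi>[of x] one_carrier_mat, of c] right_mult_one_mat[OF carr\<phi>[of x]] by simp
    finally have "H (gen x c) = scale_entries c (entries d (\<phi>' x))"
      by (simp add: H_def \<phi>'_def conj_smult entries_smult carr'[unfolded \<phi>'_def])
    then show ?thesis by (simp only:) (intro entries.span_scale entries.span_base rangeI)
  qed
  have H_single: "H (Poly_Mapping.single t n) \<in> ?S" for t n
  proof (induction n rule: int_induct[where k = 0])
    case base
    show ?case by (simp only: single_zero H.zero entries.span_zero)
  next
    case (step1 n)
    obtain x c where t: "t = Gen x c" by (cases t)
    have "H (Poly_Mapping.single t (n + 1)) = H (Poly_Mapping.single t n) + H (gen x c)"
      unfolding t single_add by (rule H.add)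
    then show ?case using step1 H_gen by (simp only: entries.span_add)
  next
    case (step2 n)
    obtain x c where t: "t = Gen x c" by (cases t)
    have "H (Poly_Mapping.single t (n - 1)) = H (Poly_Mapping.single t n) - H (gen x c)"
      unfolding t single_diff by (rule H.diff)
    then show ?case using step2 H_gen by (simp only: entries.span_diff)
  qed
  have H_all: "H P \<in> ?S" for P
  proof (induction P rule: update_induct)
    case const
    show ?case by (simp only: single_zero H.zero entries.span_zero)
  next
    case (update P t n)
    have "Poly_Mapping.update t n P = P + Poly_Mapping.single t n"
      using update(1)
      by (intro poly_mapping_eqI) (auto simp: lookup_update lookup_add lookup_single in_keys_iff when_def)
    then have "H (Poly_Mapping.update t n P) = H P + H (Poly_Mapping.single t n)" by (simp only: H.add)
    then show ?case using update(3) H_single by (simp only: entries.span_add)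
  qed
  show "square_entries d \<subseteq> ?S"
  proof
    fix x :: "'k entries" assume "x \<in> square_entries d"
    then obtain E where E: "E \<in> carrier_mat d d" "x = entries d E" unfolding square_entries_def by blast
    have hEg: "h * E * g \<in> carrier_mat d d"
      by (intro mult_carrier_mat[of _ d d] h g E)
    then obtain P where P: "h * E * g = \<Psi> P" using range by blast
    have hE: "h * E \<in> carrier_mat d d" by (rule mult_carrier_mat[OF h E(1)])
    have "g * (h * E * g) * h = g * (h * E * (g * h))"
      using assoc_mult_mat[OF g hEg h] assoc_mult_mat[OF hE g h] by simp
    also have "\<dots> = g * (h * E)" using right_mult_one_mat[OF hE] by (simp add: gh)
    also have "\<dots> = E" using assoc_mult_mat[OF g h E(1)] left_mult_one_mat[OF E(1)] by (simp add: gh)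
    finally have "x = H P" using E(2) by (simp add: H_def P)
    then show "x \<in> ?S" using H_all by simp
  qed
qed


section \<open>Cosets with a lonely cycle\<close>

theorem theorem3p11:
  fixes \<iota> :: "'f::field \<Rightarrow> 'd::division_ring"
    and j :: "'f \<Rightarrow> 'k::field"
    and \<phi> :: "'d \<Rightarrow> 'k mat"
    and d k :: nat
    and X :: "'k mat set"
    and C :: "nat set"
    and z :: 'd
    and g :: "'k mat"
  assumes "central_division_algebra \<iota>"
    and "has_degree \<iota> d"
    and "d > 2"
    and "field_hom j"
    and "splitting_representation \<iota> j d \<phi>"
    and "X \<in> carrier (weyl_group d)"
    and "C \<in> cycles d (coset_perm X)"
    and "card C = k"
    and "lonely d (coset_perm X) C"
    and "z \<noteq> 0"
    and "g \<in> carrier (GL d)"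
  shows "g \<otimes>\<^bsub>GL d\<^esub> \<phi> z \<otimes>\<^bsub>GL d\<^esub> inv\<^bsub>GL d\<^esub> g \<notin> X"
proof
  let ?h = "inv\<^bsub>GL d\<^esub> g"
  define A where "A = g * \<phi> z * ?h"
  define \<sigma> where "\<sigma> = monomial_perm A"
  assume "g \<otimes>\<^bsub>GL d\<^esub> \<phi> z \<otimes>\<^bsub>GL d\<^esub> ?h \<in> X"
  then have A: "A \<in> X" by (simp add: A_def mult_GL)
  have perm: "coset_perm X = \<sigma>"
    unfolding \<sigma>_def by (rule coset_perm_eq(3)[OF assms(6) A])
  have monomial: "monomial_matrix d A \<sigma>"
    unfolding \<sigma>_def
    by (rule monomial_matrix_monomial_perm[OF coset_perm_eq(1,2)[OF assms(6) A]])
  have g: "g \<in> carrier_mat d d" using assms(11) carrier_GL by blast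
  interpret split_element \<iota> d z j "\<lambda>x. g * \<phi> x * ?h"
    using assms(1-4) splitting_representation_facts[OF assms(5) g inv_GL[OF assms(11)]]
    by (intro split_element.intro division_algebra_element.intro split_element_axioms.intro) auto
  have "C \<in> cycles d \<sigma>" using assms(7) by (simp add: perm)
  from not_lonely[OF monomial[unfolded A_def] this] show False
    using assms(9) by (simp add: perm)
qed

end
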